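(* Let $\mathrm{A}$ be a complex $3$-dimensional binary $(-1,1)$-algebra. Then $\mathrm{A}$ is isomorphic to one of the algebras $\mathrm{A}_{01},\dots,\mathrm{A}_{11}$, $\mathrm{R}_{00}$, $\mathrm{R}_{01}$, $\mathrm{R}_{02}^{\alpha}$ ($\alpha\in\mathbb{C}$, $\alpha\neq0$), $\mathrm{R}_{03},\dots,\mathrm{R}_{16}$ listed in the context; i.e., $\mathrm{A}$ is a $(-1,1)$-algebra.
   Context: Write $(x,y,z)=(xy)z-x(yz)$. An algebra is right alternative if $(x,y,z)=-(x,z,y)$ for all $x,y,z$. A $(-1,1)$-algebra is a right alternative algebra satisfying $(x,y,z)+(y,z,x)+(z,x,y)=0$ for all $x,y,z$. An algebra is a binary $(-1,1)$-algebra if each of its subalgebras generated by two elements is a $(-1,1)$-algebra. The algebras below are given in a basis $e_1,e_2,e_3$. For $\mathrm{A}_{01},\dots,\mathrm{A}_{11}$ the multiplication is commutative, and products neither listed nor obtained from listed ones by commutativity are zero; for the others all products not listed are zero. $\mathrm{A}_{01}$: $e_1e_1=e_1$, $e_2e_2=e_2$; $\mathrm{A}_{02}$: $e_1e_1=e_1$, $e_1e_2=e_2$; $\mathrm{A}_{03}$: $e_1e_1=e_1$; $\mathrm{A}_{04}$: $e_1e_1=e_2$; $\mathrm{A}_{05}$: $e_1e_2=e_3$; $\mathrm{A}_{06}$: $e_1e_1=e_2$, $e_1e_2=e_3$; $\mathrm{A}_{07}$: $e_1e_1=e_1$, $e_2e_2=e_2$, $e_3e_3=e_3$; $\mathrm{A}_{08}$: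 $e_1e_1=e_1$, $e_2e_2=e_2$, $e_2e_3=e_3$; $\mathrm{A}_{09}$: $e_1e_1=e_1$, $e_1e_2=e_2$, $e_1e_3=e_3$; $\mathrm{A}_{10}$: $e_1e_1=e_1$, $e_1e_2=e_2$, $e_1e_3=e_3$, $e_2e_2=e_3$; $\mathrm{A}_{11}$: $e_1e_1=e_1$, $e_2e_2=e_3$; $\mathrm{R}_{00}$: $e_1e_2=e_3$, $e_2e_1=-e_3$; $\mathrm{R}_{01}$: $e_1e_1=e_2$, $e_1e_3=e_2$, $e_3e_1=-e_2$; $\mathrm{R}_{02}^{\alpha}$: $e_1e_2=(1+\alpha)e_3$, $e_2e_1=(1-\alpha)e_3$; $\mathrm{R}_{03}$: $e_1e_1=e_1$, $e_1e_2=e_2$, $e_1e_3=e_3$, $e_3e_1=e_3$; $\mathrm{R}_{04}$: $e_1e_1=e_1$, $e_1e_2=e_2+e_3$, $e_1e_3=e_3$, $e_2e_1=-e_3$, $e_3e_1=e_3$; $\mathrm{R}_{05}$: $e_1e_1=e_1$, $e_1e_3=e_3$, $e_2e_1=e_2$, $e_3e_1=e_3$; $\mathrm{R}_{06}$: $e_1e_1=e_1$, $e_1e_2=e_2$, $e_1e_3=e_3$; $\mathrm{R}_{07}$: $e_1e_1=e_1$, $e_2e_1=e_2$, $e_3e_1=e_3$; $\mathrm{R}_{08}$: $e_1e_1=e_1$, $e_1e_3=e_3$, $e_2e_1=e_2$; $\mathrm{R}_{09}$: $e_1e_1=e_1$, $e_2e_1=e_2$, $e_2e_2=e_3$; $\mathrm{R}_{10}$: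 $e_1e_1=e_1$, $e_1e_2=e_2$, $e_1e_3=e_3$, $e_2e_2=e_3$, $e_3e_1=e_3$; $\mathrm{R}_{11}$: $e_1e_1=e_1$, $e_1e_3=e_3$, $e_2e_2=e_2$, $e_3e_2=e_3$; $\mathrm{R}_{12}$: $e_1e_1=e_1$, $e_2e_1=e_2$; $\mathrm{R}_{13}$: $e_1e_1=e_1$, $e_1e_2=e_3$, $e_2e_1=e_2-e_3$; $\mathrm{R}_{14}$: $e_1e_1=e_1$, $e_1e_2=e_2$; $\mathrm{R}_{15}$: $e_1e_1=e_1$, $e_1e_3=e_3$, $e_2e_2=e_2$; $\mathrm{R}_{16}$: $e_1e_1=e_1$, $e_2e_2=e_2$, $e_3e_1=e_3$.
   Formalization: The isomorphism claim is stated for algebras whose product is not identically zero, since the 3-dimensional algebra with zero product is a binary (-1,1)-algebra but is not in the list; that A is a (-1,1)-algebra is stated in all cases. *)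

theory Defs
  imports "HOL-Analysis.Analysis"
begin

locale complex_algebra = vector_space scale
  for scale :: "complex \<Rightarrow> 'a::ab_group_add \<Rightarrow> 'a" +
  fixes mul :: "'a \<Rightarrow> 'a \<Rightarrow> 'a"
  assumes linear_mul_right: "Vector_Spaces.linear scale scale (\<lambda>y. mul x y)"
    and linear_mul_left: "Vector_Spaces.linear scale scale (\<lambda>x. mul x y)"
begin

definition subalgebra :: "'a set \<Rightarrow> bool" where
  "subalgebra S \<longleftrightarrow> subspace S \<and> (\<forall>x\<in>S. \<forall>y\<in>S. mul x y \<in> S)"

definition associator :: "'a \<Rightarrow> 'a \<Rightarrow> 'a \<Rightarrow> 'a" where
  "associator x y z = mul (mul x y) z - mul x (mul y z)"

definition right_alternative_on :: "'a set \<Rightarrow> bool" where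
  "right_alternative_on S \<longleftrightarrow>
     (\<forall>x\<in>S. \<forall>y\<in>S. \<forall>z\<in>S. associator x y z = - associator x z y)"

text \<open>For a subalgebra \<open>S\<close>: with the restricted operations, \<open>S\<close> is a \<open>(-1,1)\<close>-algebra.\<close>

definition minus_one_one_on :: "'a set \<Rightarrow> bool" where
  "minus_one_one_on S \<longleftrightarrow> right_alternative_on S \<and>
     (\<forall>x\<in>S. \<forall>y\<in>S. \<forall>z\<in>S.
        associator x y z + associator y z x + associator z x y = 0)"

definition minus_one_one :: bool where
  "minus_one_one \<longleftrightarrow> minus_one_one_on UNIV"

definition binary_minus_one_one :: bool where
  "binary_minus_one_one \<longleftrightarrow> (\<forall>x y. minus_one_one_on (subalgebra hull {x, y}))"

end

definition isomorphic_algebras ::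
  "(complex \<Rightarrow> 'a::ab_group_add \<Rightarrow> 'a) \<Rightarrow> ('a \<Rightarrow> 'a \<Rightarrow> 'a) \<Rightarrow>
   (complex \<Rightarrow> 'b::ab_group_add \<Rightarrow> 'b) \<Rightarrow> ('b \<Rightarrow> 'b \<Rightarrow> 'b) \<Rightarrow> bool" where
  "isomorphic_algebras s1 mul1 s2 mul2 \<longleftrightarrow>
     (\<exists>f. Vector_Spaces.linear s1 s2 f \<and> bij f \<and>
          (\<forall>x y. f (mul1 x y) = mul2 (f x) (f y)))"

text \<open>
  The concrete algebras live on \<^typ>\<open>complex^3\<close> with standard basis \<open>e 1, e 2, e 3\<close> (in the index
  type \<^typ>\<open>3\<close> the literal \<open>3\<close> is a third element, equal to \<open>0\<close>).  A multiplication table is a list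
  of triples \<open>(i, j, v)\<close>, each saying that \<open>e i * e j = v\<close>, with all other products of basis
  vectors zero; no pair \<open>(i, j)\<close> occurs twice in the tables below.
\<close>

type_synonym table = "(3 \<times> 3 \<times> (complex^3)) list"

abbreviation e :: "3 \<Rightarrow> complex^3" where
  "e i \<equiv> axis i 1"

definition table_mul :: "table \<Rightarrow> complex^3 \<Rightarrow> complex^3 \<Rightarrow> complex^3" where
  "table_mul t x y = (\<Sum>(i, j, v)\<leftarrow>t. (x $ i * y $ j) *s v)"

definition comm_table_mul :: "table \<Rightarrow> complex^3 \<Rightarrow> complex^3 \<Rightarrow> complex^3" where
  "comm_table_mul t = table_mul (t @ [(j, i, v). (i, j, v) \<leftarrow> t, i \<noteq> j])"

lemma complex_algebra_table_mul: "complex_algebra (*s) (table_mul t)"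
proof -
  have add: "table_mul t (x + x') y = table_mul t x y + table_mul t x' y"
    "table_mul t x (y + y') = table_mul t x y + table_mul t x y'" for x x' y y'
    unfolding table_mul_def
    by (induction t) (auto simp: vec_eq_iff algebra_simps)
  have scale: "table_mul t (c *s x) y = c *s table_mul t x y"
    "table_mul t x (c *s y) = c *s table_mul t x y" for c x y
    unfolding table_mul_def
    by (induction t) (auto simp: vec_eq_iff algebra_simps)
  show ?thesis
    by unfold_locales (simp_all add: add scale vec.scale_right_distrib vec.scale_left_distrib)
qed

definition A01 where "A01 = comm_table_mul [(1, 1, e 1), (2, 2, e 2)]"
definition A02 where "A02 = comm_table_mul [(1, 1, e 1), (1, 2, e 2)]"
definition A03 where "A03 = comm_table_mul [(1, 1, e 1)]"
definition A04 where "A04 = comm_table_mul [(1, 1, e 2)]"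
definition A05 where "A05 = comm_table_mul [(1, 2, e 3)]"
definition A06 where "A06 = comm_table_mul [(1, 1, e 2), (1, 2, e 3)]"
definition A07 where "A07 = comm_table_mul [(1, 1, e 1), (2, 2, e 2), (3, 3, e 3)]"
definition A08 where "A08 = comm_table_mul [(1, 1, e 1), (2, 2, e 2), (2, 3, e 3)]"
definition A09 where "A09 = comm_table_mul [(1, 1, e 1), (1, 2, e 2), (1, 3, e 3)]"
definition A10 where
  "A10 = comm_table_mul [(1, 1, e 1), (1, 2, e 2), (1, 3, e 3), (2, 2, e 3)]"
definition A11 where "A11 = comm_table_mul [(1, 1, e 1), (2, 2, e 3)]"

definition R00 where "R00 = table_mul [(1, 2, e 3), (2, 1, - e 3)]"
definition R01 where "R01 = table_mul [(1, 1, e 2), (1, 3, e 2), (3, 1, - e 2)]"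
definition R02 :: "complex \<Rightarrow> complex^3 \<Rightarrow> complex^3 \<Rightarrow> complex^3" where
  "R02 \<alpha> = table_mul [(1, 2, (1 + \<alpha>) *s e 3), (2, 1, (1 - \<alpha>) *s e 3)]"
definition R03 where "R03 = table_mul [(1, 1, e 1), (1, 2, e 2), (1, 3, e 3), (3, 1, e 3)]"
definition R04 where
  "R04 = table_mul [(1, 1, e 1), (1, 2, e 2 + e 3), (1, 3, e 3), (2, 1, - e 3), (3, 1, e 3)]"
definition R05 where "R05 = table_mul [(1, 1, e 1), (1, 3, e 3), (2, 1, e 2), (3, 1, e 3)]"
definition R06 where "R06 = table_mul [(1, 1, e 1), (1, 2, e 2), (1, 3, e 3)]"
definition R07 where "R07 = table_mul [(1, 1, e 1), (2, 1, e 2), (3, 1, e 3)]"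
definition R08 where "R08 = table_mul [(1, 1, e 1), (1, 3, e 3), (2, 1, e 2)]"
definition R09 where "R09 = table_mul [(1, 1, e 1), (2, 1, e 2), (2, 2, e 3)]"
definition R10 where
  "R10 = table_mul [(1, 1, e 1), (1, 2, e 2), (1, 3, e 3), (2, 2, e 3), (3, 1, e 3)]"
definition R11 where "R11 = table_mul [(1, 1, e 1), (1, 3, e 3), (2, 2, e 2), (3, 2, e 3)]"
definition R12 where "R12 = table_mul [(1, 1, e 1), (2, 1, e 2)]"
definition R13 where "R13 = table_mul [(1, 1, e 1), (1, 2, e 3), (2, 1, e 2 - e 3)]"
definition R14 where "R14 = table_mul [(1, 1, e 1), (1, 2, e 2)]"
definition R15 where "R15 = table_mul [(1, 1, e 1), (1, 3, e 3), (2, 2, e 2)]"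
definition R16 where "R16 = table_mul [(1, 1, e 1), (2, 2, e 2), (3, 1, e 3)]"

end

(*
  Right alternativity alone already forces a 3-dimensional complex algebra into the list: it is an
  identity in two variables, so it passes from the 2-generated subalgebras to the whole algebra, and
  the cyclic identity is then read off the multiplication tables.

  If there is no nonzero idempotent, either all squares vanish, or some x has x, x^2, x^3 independent
  with x^4 = 0, or all cubes vanish and multiplication is a bilinear form with values in the line
  of x^2.  If i is an idempotent, right multiplication R by i is a projection.  Rank 2: the
  identities applied to i determine left multiplication by i up to a few normal forms, each leaving
  few free structure constants.  Rank 1: the complement is either handled directly or contains an
  idempotent that produces one of rank 2.  If all nonzero idempotents are right units, then either
  the algebra is unital with only the trivial idempotents, or left multiplication by i has a kernel,
  which every element annihilates from the left.
*)
theory Submission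
  imports Defs "HOL-Computational_Algebra.Fundamental_Theorem_Algebra"
begin

section \<open>The list of algebras and its cyclic identity\<close>

definition listed :: "(complex^3 \<Rightarrow> complex^3 \<Rightarrow> complex^3) set" where
  "listed = {A01, A02, A03, A04, A05, A06, A07, A08, A09, A10, A11,
      R00, R01, R03, R04, R05, R06, R07, R08, R09, R10, R11,
      R12, R13, R14, R15, R16} \<union> {R02 \<alpha> | \<alpha>. \<alpha> \<noteq> 0}"

lemmas listed_defs = A01_def A02_def A03_def A04_def A05_def A06_def A07_def A08_def A09_def A10_def
  A11_def R00_def R01_def R02_def R03_def R04_def R05_def R06_def R07_def R08_def R09_def R10_def
  R11_def R12_def R13_def R14_def R15_def R16_def

lemmas table_simps = listed_defs vec_eq_iff forall_3 vector_3 table_mul_def comm_table_mul_def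
  axis_def Let_def algebra_simps

text \<open>For a concrete table the identity is polynomial in the nine coordinates of
  \<open>x\<close>, \<open>y\<close>, \<open>z\<close>, so each algebra is settled by expansion, the
  family \<open>R02\<close> with its parameter kept symbolic.\<close>

lemma listed_cyclic:
  assumes "B \<in> listed"
  shows "(B (B x y) z - B x (B y z)) + (B (B y z) x - B y (B z x)) +
    (B (B z x) y - B z (B x y)) = 0"
  using assms unfolding listed_def
  by (elim UnE insertE CollectE exE conjE emptyE)
    (simp_all add: table_simps)

section \<open>Coordinates in a right alternative algebra\<close>

text \<open>The law is taken in its quadratic form because this form involves only two elements and
  can be read off two-generated subalgebras.\<close>

locale right_alternative_3d = complex_algebra scale mul
  for scale :: "complex \<Rightarrow> 'a::ab_group_add \<Rightarrow> 'a" (infixr "\<cdot>" 75)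
    and mul :: "'a \<Rightarrow> 'a \<Rightarrow> 'a" (infixl "\<star>" 70) +
  assumes dim_UNIV: "dim UNIV = 3"
    and right_alternative: "(x \<star> y) \<star> y = x \<star> (y \<star> y)"
begin

lemma mul_simps [simp]:
  "(x + y) \<star> z = x \<star> z + y \<star> z" "z \<star> (x + y) = z \<star> x + z \<star> y"
  "(x - y) \<star> z = x \<star> z - y \<star> z" "z \<star> (x - y) = z \<star> x - z \<star> y"
  "(- x) \<star> z = - (x \<star> z)" "z \<star> (- x) = - (z \<star> x)"
  "(c \<cdot> x) \<star> z = c \<cdot> (x \<star> z)" "z \<star> (c \<cdot> x) = c \<cdot> (z \<star> x)"
  "0 \<star> z = 0" "z \<star> 0 = 0"
proof -
  interpret r: Vector_Spaces.linear scale scale "\<lambda>y. z \<star> y" by (rule linear_mul_right)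
  interpret l: Vector_Spaces.linear scale scale "\<lambda>x. x \<star> z" by (rule linear_mul_left)
  show "(x + y) \<star> z = x \<star> z + y \<star> z" "z \<star> (x + y) = z \<star> x + z \<star> y"
    "(x - y) \<star> z = x \<star> z - y \<star> z" "z \<star> (x - y) = z \<star> x - z \<star> y"
    "(- x) \<star> z = - (x \<star> z)" "z \<star> (- x) = - (z \<star> x)"
    "(c \<cdot> x) \<star> z = c \<cdot> (x \<star> z)" "z \<star> (c \<cdot> x) = c \<cdot> (z \<star> x)"
    "0 \<star> z = 0" "z \<star> 0 = 0"
    by (simp_all add: l.add r.add l.diff r.diff l.neg r.neg l.scale r.scale)
qed

text \<open>Polarisation: replace \<open>y\<close> by \<open>y + z\<close> in the quadratic law and
  cancel the pure terms. With an idempotent \<open>i\<close> among the arguments it relates left and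
  right multiplication by \<open>i\<close>, which is the main source of equations below.\<close>

lemma right_alternative_lin:
  "(x \<star> y) \<star> z + (x \<star> z) \<star> y = x \<star> (y \<star> z) + x \<star> (z \<star> y)"
  using right_alternative[of x "y + z"] right_alternative[of x y] right_alternative[of x z]
  by (simp add: algebra_simps)

section \<open>Bases and coordinate functionals\<close>

definition basis3 :: "'a \<Rightarrow> 'a \<Rightarrow> 'a \<Rightarrow> bool" where
  "basis3 x y z \<longleftrightarrow> (\<forall>a b c. a \<cdot> x + b \<cdot> y + c \<cdot> z = 0 \<longrightarrow> a = 0 \<and> b = 0 \<and> c = 0)"

text \<open>The functionals of the dual basis, characterised by expansion and uniqueness; their
  linearity is a consequence.\<close>

definition coordinates ::
  "'a \<Rightarrow> 'a \<Rightarrow> 'a \<Rightarrow> ('a \<Rightarrow> complex) \<Rightarrow> ('a \<Rightarrow> complex) \<Rightarrow> ('a \<Rightarrow> complex) \<Rightarrow> bool" where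
  "coordinates x y z f g h \<longleftrightarrow>
     (\<forall>w. w = f w \<cdot> x + g w \<cdot> y + h w \<cdot> z) \<and>
     (\<forall>a b c. f (a \<cdot> x + b \<cdot> y + c \<cdot> z) = a \<and> g (a \<cdot> x + b \<cdot> y + c \<cdot> z) = b \<and>
        h (a \<cdot> x + b \<cdot> y + c \<cdot> z) = c)"

lemma basis3_distinct:
  assumes "basis3 x y z"
  shows "x \<noteq> y" "x \<noteq> z" "y \<noteq> z"
  using assms[unfolded basis3_def, rule_format, of 1 "-1" 0]
    assms[unfolded basis3_def, rule_format, of 1 0 "-1"]
    assms[unfolded basis3_def, rule_format, of 0 1 "-1"] by auto

text \<open>Independence of a set cannot see that two of the listed vectors coincide, whence the
  cardinality condition.\<close>

lemma basis3_iff: "basis3 x y z \<longleftrightarrow> independent {x, y, z} \<and> card {x, y, z} = 3"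
proof
  assume b: "basis3 x y z"
  note d = basis3_distinct[OF b]
  have "independent {x, y, z}"
    by (rule independent_if_scalars_zero) (use b d in \<open>auto simp: basis3_def add.assoc\<close>)
  with d show "independent {x, y, z} \<and> card {x, y, z} = 3" by auto
next
  assume "independent {x, y, z} \<and> card {x, y, z} = 3"
  then have i: "independent {x, y, z}" and d: "x \<noteq> y" "x \<noteq> z" "y \<noteq> z"
    by (auto simp: card_insert_if split: if_splits)
  show "basis3 x y z"
    unfolding basis3_def
  proof (intro allI impI)
    fix a b c assume s: "a \<cdot> x + b \<cdot> y + c \<cdot> z = 0"
    define u where "u w = (if w = x then a else if w = y then b else c)" for w
    have "(\<Sum>w\<in>{x, y, z}. u w \<cdot> w) = 0"
      using d s by (auto simp: u_def add.assoc)
    then have "\<forall>w\<in>{x, y, z}. u w = 0"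
      using independentD[OF i, of "{x, y, z}" u] by blast
    then show "a = 0 \<and> b = 0 \<and> c = 0"
      using d by (auto simp: u_def split: if_splits)
  qed
qed

lemma exists_coordinates:
  assumes b: "basis3 x y z"
  obtains f g h where "coordinates x y z f g h"
proof -
  let ?B = "{x, y, z}"
  from b have i: "independent ?B" and c: "card ?B = 3" by (auto simp: basis3_iff)
  have "\<forall>w. \<exists>a b c. w = a \<cdot> x + b \<cdot> y + c \<cdot> z"
  proof
    fix w
    \<comment> \<open>A vector outside the span would give four independent vectors inside a basis
      with three elements.\<close>
    have "w \<in> span ?B"
    proof (rule ccontr)
      assume w: "w \<notin> span ?B"
      then have "independent (insert w ?B)" using i by (rule independent_insertI)
      then obtain C where C: "insert w ?B \<subseteq> C" "independent C" "UNIV \<subseteq> span C"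
        by (rule maximal_independent_subset_extend[OF subset_UNIV]) auto
      then have "card C = 3" using dim_UNIV dim_unique[of C UNIV] by auto
      moreover have "card (insert w ?B) = 4"
        using w c span_superset[of ?B] by (subst card_insert_disjoint) auto
      ultimately show False
        using card_mono[of C "insert w ?B"] C(1) by (simp add: card_ge_0_finite)
    qed
    then show "\<exists>a b c. w = a \<cdot> x + b \<cdot> y + c \<cdot> z"
      by (auto simp: span_insert span_singleton algebra_simps)
  qed
  then obtain f g h where r: "\<And>w. w = f w \<cdot> x + g w \<cdot> y + h w \<cdot> z" by metis
  have "f (a \<cdot> x + b' \<cdot> y + c \<cdot> z) = a \<and> g (a \<cdot> x + b' \<cdot> y + c \<cdot> z) = b' \<and>
        h (a \<cdot> x + b' \<cdot> y + c \<cdot> z) = c" for a b' c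
  proof -
    let ?w = "a \<cdot> x + b' \<cdot> y + c \<cdot> z"
    have "(f ?w - a) \<cdot> x + (g ?w - b') \<cdot> y + (h ?w - c) \<cdot> z = 0"
      using r[of ?w] by (simp add: algebra_simps)
    with b have "f ?w - a = 0 \<and> g ?w - b' = 0 \<and> h ?w - c = 0" unfolding basis3_def by blast
    then show ?thesis by simp
  qed
  with r that show thesis unfolding coordinates_def by blast
qed

lemma coordinates_simps:
  assumes "coordinates x y z f g h"
  shows "f (v + w) = f v + f w" "g (v + w) = g v + g w" "h (v + w) = h v + h w"
    "f (v - w) = f v - f w" "g (v - w) = g v - g w" "h (v - w) = h v - h w"
    "f (- w) = - f w" "g (- w) = - g w" "h (- w) = - h w"
    "f (c \<cdot> w) = c * f w" "g (c \<cdot> w) = c * g w" "h (c \<cdot> w) = c * h w"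
    "f 0 = 0" "g 0 = 0" "h 0 = 0"
    "f x = 1" "g x = 0" "h x = 0"
    "f y = 0" "g y = 1" "h y = 0"
    "f z = 0" "g z = 0" "h z = 1"
proof -
  from assms have r: "\<And>w. w = f w \<cdot> x + g w \<cdot> y + h w \<cdot> z"
    and s: "\<And>a b c. f (a \<cdot> x + b \<cdot> y + c \<cdot> z) = a" "\<And>a b c. g (a \<cdot> x + b \<cdot> y + c \<cdot> z) = b"
      "\<And>a b c. h (a \<cdot> x + b \<cdot> y + c \<cdot> z) = c"
    by (auto simp: coordinates_def)
  note s' = s[of "f v + f w" "g v + g w" "h v + h w"] s[of "f v - f w" "g v - g w" "h v - h w"]
    s[of "- f w" "- g w" "- h w"] s[of "c * f w" "c * g w" "c * h w"]
  have "v + w = (f v + f w) \<cdot> x + (g v + g w) \<cdot> y + (h v + h w) \<cdot> z"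
    by (subst r[of v], subst r[of w]) (simp add: algebra_simps)
  moreover have "v - w = (f v - f w) \<cdot> x + (g v - g w) \<cdot> y + (h v - h w) \<cdot> z"
    by (subst r[of v], subst r[of w]) (simp add: algebra_simps)
  moreover have "- w = (- f w) \<cdot> x + (- g w) \<cdot> y + (- h w) \<cdot> z"
    by (subst r[of w]) (simp add: algebra_simps)
  moreover have "c \<cdot> w = (c * f w) \<cdot> x + (c * g w) \<cdot> y + (c * h w) \<cdot> z"
    by (subst r[of w]) (simp add: algebra_simps)
  ultimately
  show "f (v + w) = f v + f w" "g (v + w) = g v + g w" "h (v + w) = h v + h w"
    "f (v - w) = f v - f w" "g (v - w) = g v - g w" "h (v - w) = h v - h w"
    "f (- w) = - f w" "g (- w) = - g w" "h (- w) = - h w"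
    "f (c \<cdot> w) = c * f w" "g (c \<cdot> w) = c * g w" "h (c \<cdot> w) = c * h w"
    using s' by metis+
  show "f 0 = 0" "g 0 = 0" "h 0 = 0" "f x = 1" "g x = 0" "h x = 0"
    "f y = 0" "g y = 1" "h y = 0" "f z = 0" "g z = 0" "h z = 1"
    using s[of 0 0 0] s[of 1 0 0] s[of 0 1 0] s[of 0 0 1] by simp_all
qed

text \<open>As a rewrite rule this splits a vector equation into three scalar ones; the structure
  constants below are determined in this way.\<close>

lemma coordinates_eq_iff:
  assumes "coordinates x y z f g h"
  shows "v = w \<longleftrightarrow> f v = f w \<and> g v = g w \<and> h v = h w"
  using assms unfolding coordinates_def by metis

lemma coordinates_expand:
  assumes "coordinates x y z f g h"
  shows "w = f w \<cdot> x + g w \<cdot> y + h w \<cdot> z"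
  using assms unfolding coordinates_def by blast

text \<open>Cramer's rule: the expression assumed nonzero is the determinant of the coordinates of
  \<open>u\<close>, \<open>v\<close>, \<open>w\<close>, and its product with each coefficient of a
  linear relation is zero.\<close>

lemma basis3I:
  assumes "coordinates x y z f g h"
    and "f u * (g v * h w - h v * g w) - g u * (f v * h w - h v * f w)
         + h u * (f v * g w - g v * f w) \<noteq> 0" (is "?D \<noteq> 0")
  shows "basis3 u v w"
  unfolding basis3_def
proof (intro allI impI)
  fix a b c assume s: "a \<cdot> u + b \<cdot> v + c \<cdot> w = 0"
  note cs = coordinates_simps[OF assms(1)]
  have 1: "a * f u + b * f v + c * f w = 0" "a * g u + b * g v + c * g w = 0"
    "a * h u + b * h v + c * h w = 0"
    using arg_cong[OF s, of f] arg_cong[OF s, of g] arg_cong[OF s, of h] by (simp_all add: cs)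
  have "?D * a = 0" "?D * b = 0" "?D * c = 0" using 1 by algebra+
  with assms(2) show "a = 0 \<and> b = 0 \<and> c = 0" by simp
qed

lemma independent2I:
  assumes "\<And>c. y \<noteq> c \<cdot> x" "x \<noteq> 0" "a \<cdot> x + b \<cdot> y = 0"
  shows "a = 0 \<and> b = 0"
proof -
  have "b = 0"
  proof (rule ccontr)
    assume "b \<noteq> 0"
    have "b \<cdot> y = (- a) \<cdot> x"
      using assms(3) by (simp add: eq_neg_iff_add_eq_0 add.commute)
    then have "(1 / b) \<cdot> (b \<cdot> y) = (1 / b) \<cdot> ((- a) \<cdot> x)" by simp
    then have "y = (1 / b * - a) \<cdot> x" using \<open>b \<noteq> 0\<close> by simp
    with assms(1) show False by blast
  qed
  with assms show ?thesis by simp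
qed

lemma basis3I_extend:
  assumes "\<And>c. y \<noteq> c \<cdot> x" "x \<noteq> 0" "\<And>a b. z \<noteq> a \<cdot> x + b \<cdot> y"
  shows "basis3 x y z"
  unfolding basis3_def
proof (intro allI impI)
  fix a b c assume s: "a \<cdot> x + b \<cdot> y + c \<cdot> z = 0"
  have "c = 0"
  proof (rule ccontr)
    assume "c \<noteq> 0"
    have "c \<cdot> z = - (a \<cdot> x + b \<cdot> y)"
      by (intro eq_neg_iff_add_eq_0[THEN iffD2]) (use s in \<open>simp add: add.commute\<close>)
    then have "(1 / c) \<cdot> (c \<cdot> z) = (1 / c) \<cdot> (- (a \<cdot> x + b \<cdot> y))" by simp
    then have "z = (1 / c * - a) \<cdot> x + (1 / c * - b) \<cdot> y"
      using \<open>c \<noteq> 0\<close> by (simp add: scale_right_diff_distrib)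
    with assms(3) show False by blast
  qed
  with s independent2I[OF assms(1,2), of a b] show "a = 0 \<and> b = 0 \<and> c = 0" by simp
qed

lemma exists_basis3_2:
  assumes "\<And>a b. a \<cdot> x + b \<cdot> y = 0 \<Longrightarrow> a = 0 \<and> b = 0"
  obtains z where "basis3 x y z"
proof -
  have "x \<noteq> y" using assms[of 1 "-1"] by auto
  have "span {x, y} \<noteq> UNIV"
  proof
    assume "span {x, y} = UNIV"
    then have "dim UNIV \<le> card {x, y}" by (intro dim_le_card) auto
    then show False using dim_UNIV \<open>x \<noteq> y\<close> by simp
  qed
  then obtain z where z: "z \<notin> span {x, y}" by auto
  have "basis3 x y z"
  proof (rule basis3I_extend)
    show "y \<noteq> c \<cdot> x" for c using assms[of c "-1"] by auto
    show "x \<noteq> 0" using assms[of 1 0] by auto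
    show "z \<noteq> a \<cdot> x + b \<cdot> y" for a b
      using z by (metis insertCI span_add span_base span_scale)
  qed
  then show thesis by (rule that)
qed

lemma exists_basis3_1:
  assumes "x \<noteq> 0"
  obtains y z where "basis3 x y z"
proof -
  have "span {x} \<noteq> UNIV"
  proof
    assume "span {x} = UNIV"
    then have "dim UNIV \<le> card {x}" by (intro dim_le_card) auto
    then show False using dim_UNIV by simp
  qed
  then obtain y where y: "y \<notin> span {x}" by auto
  have "y \<noteq> c \<cdot> x" for c using y by (metis insertCI span_base span_scale)
  then have "a = 0 \<and> b = 0" if "a \<cdot> x + b \<cdot> y = 0" for a b
    using assms that by (rule independent2I)
  then obtain z where "basis3 x y z" by (rule exists_basis3_2)
  then show thesis by (rule that)
qed

section \<open>Recognizing the tables\<close>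

definition classified :: bool where
  "classified \<longleftrightarrow> (\<exists>B\<in>listed. isomorphic_algebras scale mul (*s) B)"

definition table3 ::
  "'a \<Rightarrow> 'a \<Rightarrow> 'a \<Rightarrow> 'a \<Rightarrow> 'a \<Rightarrow> 'a \<Rightarrow> 'a \<Rightarrow> 'a \<Rightarrow> 'a \<Rightarrow> 'a \<Rightarrow> 'a \<Rightarrow> 'a \<Rightarrow> bool" where
  "table3 x y z xx xy xz yx yy yz zx zy zz \<longleftrightarrow> basis3 x y z \<and>
     x \<star> x = xx \<and> x \<star> y = xy \<and> x \<star> z = xz \<and>
     y \<star> x = yx \<and> y \<star> y = yy \<and> y \<star> z = yz \<and>
     z \<star> x = zx \<and> z \<star> y = zy \<and> z \<star> z = zz"

text \<open>The isomorphism sends a vector to its coordinate triple; by bilinearity it suffices to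
  compare products of two general linear combinations of the basis.\<close>

lemma classifiedI:
  assumes t: "table3 x y z xx xy xz yx yy yz zx zy zz"
    and B: "B \<in> listed"
    and hom: "\<And>f g h a b c a' b' c'. coordinates x y z f g h \<Longrightarrow>
       (let p = (a * a') \<cdot> xx + (a * b') \<cdot> xy + (a * c') \<cdot> xz +
             (b * a') \<cdot> yx + (b * b') \<cdot> yy + (b * c') \<cdot> yz +
             (c * a') \<cdot> zx + (c * b') \<cdot> zy + (c * c') \<cdot> zz
        in vector [f p, g p, h p] = B (vector [a, b, c]) (vector [a', b', c']))"
  shows classified
proof -
  from t have "basis3 x y z" by (simp add: table3_def)
  then obtain f g h where c: "coordinates x y z f g h" using exists_coordinates by blast
  note cs = coordinates_simps[OF c]
  interpret v: vector_space "(*s) :: complex \<Rightarrow> complex^3 \<Rightarrow> complex^3"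
    by unfold_locales (simp_all add: vec.scale_right_distrib vec.scale_left_distrib)
  let ?F = "\<lambda>w. vector [f w, g w, h w] :: complex^3"
  have lin: "Vector_Spaces.linear scale (*s) ?F"
    by unfold_locales (simp_all add: cs vec_eq_iff forall_3 vector_3)
  have bij: "bij ?F"
  proof (rule bijI)
    show "inj ?F"
      by (rule injI) (simp add: vec_eq_iff forall_3 vector_3 coordinates_eq_iff[OF c])
    show "surj ?F"
      by (rule surjI[where f = "\<lambda>v. (v $ 1) \<cdot> x + (v $ 2) \<cdot> y + (v $ 3) \<cdot> z"])
        (simp add: cs vec_eq_iff forall_3 vector_3)
  qed
  have "?F (v \<star> w) = B (?F v) (?F w)" for v w
  proof -
    have "v \<star> w = (f v * f w) \<cdot> xx + (f v * g w) \<cdot> xy + (f v * h w) \<cdot> xz +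
             (g v * f w) \<cdot> yx + (g v * g w) \<cdot> yy + (g v * h w) \<cdot> yz +
             (h v * f w) \<cdot> zx + (h v * g w) \<cdot> zy + (h v * h w) \<cdot> zz"
      using t unfolding table3_def
      by (subst coordinates_expand[OF c, of v], subst coordinates_expand[OF c, of w])
        (simp add: scale_right_distrib ac_simps)
    with hom[OF c, of "f v" "f w" "g w" "h w" "g v" "h v"] show ?thesis by (simp add: Let_def)
  qed
  with lin bij B show ?thesis
    unfolding isomorphic_algebras_def classified_def by blast
qed

text \<open>Exit rules for the case analysis: a case is closed by exhibiting a basis with prescribed
  products.\<close>

lemma
  shows A01I: "table3 x y z x 0 0 0 y 0 0 0 0 \<Longrightarrow> classified"
    and A02I: "table3 x y z x y 0 y 0 0 0 0 0 \<Longrightarrow> classified"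
    and A03I: "table3 x y z x 0 0 0 0 0 0 0 0 \<Longrightarrow> classified"
    and A04I: "table3 x y z y 0 0 0 0 0 0 0 0 \<Longrightarrow> classified"
    and A05I: "table3 x y z 0 z 0 z 0 0 0 0 0 \<Longrightarrow> classified"
    and A06I: "table3 x y z y z 0 z 0 0 0 0 0 \<Longrightarrow> classified"
    and A07I: "table3 x y z x 0 0 0 y 0 0 0 z \<Longrightarrow> classified"
    and A08I: "table3 x y z x 0 0 0 y z 0 z 0 \<Longrightarrow> classified"
    and A09I: "table3 x y z x y z y 0 0 z 0 0 \<Longrightarrow> classified"
    and A10I: "table3 x y z x y z y z 0 z 0 0 \<Longrightarrow> classified"
    and A11I: "table3 x y z x 0 0 0 z 0 0 0 0 \<Longrightarrow> classified"
    and R00I: "table3 x y z 0 z 0 (- z) 0 0 0 0 0 \<Longrightarrow> classified"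
    and R01I: "table3 x y z y 0 y 0 0 0 (- y) 0 0 \<Longrightarrow> classified"
    and R02I: "table3 x y z 0 ((1 + \<alpha>) \<cdot> z) 0 ((1 - \<alpha>) \<cdot> z) 0 0 0 0 0 \<Longrightarrow> \<alpha> \<noteq> 0 \<Longrightarrow> classified"
    and R03I: "table3 x y z x y z 0 0 0 z 0 0 \<Longrightarrow> classified"
    and R04I: "table3 x y z x (y + z) z (- z) 0 0 z 0 0 \<Longrightarrow> classified"
    and R05I: "table3 x y z x 0 z y 0 0 z 0 0 \<Longrightarrow> classified"
    and R06I: "table3 x y z x y z 0 0 0 0 0 0 \<Longrightarrow> classified"
    and R07I: "table3 x y z x 0 0 y 0 0 z 0 0 \<Longrightarrow> classified"
    and R08I: "table3 x y z x 0 z y 0 0 0 0 0 \<Longrightarrow> classified"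
    and R09I: "table3 x y z x 0 0 y z 0 0 0 0 \<Longrightarrow> classified"
    and R10I: "table3 x y z x y z 0 z 0 z 0 0 \<Longrightarrow> classified"
    and R11I: "table3 x y z x 0 z 0 y 0 0 z 0 \<Longrightarrow> classified"
    and R12I: "table3 x y z x 0 0 y 0 0 0 0 0 \<Longrightarrow> classified"
    and R13I: "table3 x y z x z 0 (y - z) 0 0 0 0 0 \<Longrightarrow> classified"
    and R14I: "table3 x y z x y 0 0 0 0 0 0 0 \<Longrightarrow> classified"
    and R15I: "table3 x y z x 0 z 0 y 0 0 0 0 \<Longrightarrow> classified"
    and R16I: "table3 x y z x 0 0 0 y 0 z 0 0 \<Longrightarrow> classified"
  subgoal by (erule classifiedI[where B = A01]) (auto simp: listed_def coordinates_simps table_simps)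
  subgoal by (erule classifiedI[where B = A02]) (auto simp: listed_def coordinates_simps table_simps)
  subgoal by (erule classifiedI[where B = A03]) (auto simp: listed_def coordinates_simps table_simps)
  subgoal by (erule classifiedI[where B = A04]) (auto simp: listed_def coordinates_simps table_simps)
  subgoal by (erule classifiedI[where B = A05]) (auto simp: listed_def coordinates_simps table_simps)
  subgoal by (erule classifiedI[where B = A06]) (auto simp: listed_def coordinates_simps table_simps)
  subgoal by (erule classifiedI[where B = A07]) (auto simp: listed_def coordinates_simps table_simps)
  subgoal by (erule classifiedI[where B = A08]) (auto simp: listed_def coordinates_simps table_simps)
  subgoal by (erule classifiedI[where B = A09]) (auto simp: listed_def coordinates_simps table_simps)
  subgoal by (erule classifiedI[where B = A10]) (auto simp: listed_def coordinates_simps table_simps)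
  subgoal by (erule classifiedI[where B = A11]) (auto simp: listed_def coordinates_simps table_simps)
  subgoal by (erule classifiedI[where B = R00]) (auto simp: listed_def coordinates_simps table_simps)
  subgoal by (erule classifiedI[where B = R01]) (auto simp: listed_def coordinates_simps table_simps)
  subgoal by (erule classifiedI[where B = "R02 \<alpha>"]) (auto simp: listed_def coordinates_simps table_simps)
  subgoal by (erule classifiedI[where B = R03]) (auto simp: listed_def coordinates_simps table_simps)
  subgoal by (erule classifiedI[where B = R04]) (auto simp: listed_def coordinates_simps table_simps)
  subgoal by (erule classifiedI[where B = R05]) (auto simp: listed_def coordinates_simps table_simps)
  subgoal by (erule classifiedI[where B = R06]) (auto simp: listed_def coordinates_simps table_simps)
  subgoal by (erule classifiedI[where B = R07]) (auto simp: listed_def coordinates_simps table_simps)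
  subgoal by (erule classifiedI[where B = R08]) (auto simp: listed_def coordinates_simps table_simps)
  subgoal by (erule classifiedI[where B = R09]) (auto simp: listed_def coordinates_simps table_simps)
  subgoal by (erule classifiedI[where B = R10]) (auto simp: listed_def coordinates_simps table_simps)
  subgoal by (erule classifiedI[where B = R11]) (auto simp: listed_def coordinates_simps table_simps)
  subgoal by (erule classifiedI[where B = R12]) (auto simp: listed_def coordinates_simps table_simps)
  subgoal by (erule classifiedI[where B = R13]) (auto simp: listed_def coordinates_simps table_simps)
  subgoal by (erule classifiedI[where B = R14]) (auto simp: listed_def coordinates_simps table_simps)
  subgoal by (erule classifiedI[where B = R15]) (auto simp: listed_def coordinates_simps table_simps)
  subgoal by (erule classifiedI[where B = R16]) (auto simp: listed_def coordinates_simps table_simps)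
  done

section \<open>Idempotents of rank two\<close>

text \<open>Left multiplication by \<open>i\<close> is a nilpotent Jordan block on the span of
  \<open>u\<close> and \<open>v\<close>. Right multiplication by \<open>i\<close> has only the
  eigenvalues 0 and 1, so polarised identities kill the products of \<open>u\<close> and
  \<open>v\<close> one after another, except \<open>u \<star> u\<close>, which is a multiple of
  \<open>v\<close>.\<close>

lemma classified_rank2_left_nilpotent:
  assumes b: "basis3 i u v" and P: "i \<star> i = i" "i \<star> u = v" "u \<star> i = u" "i \<star> v = 0" "v \<star> i = 0"
  shows classified
proof -
  obtain f g h where c: "coordinates i u v f g h" using b by (rule exists_coordinates)
  note [simp] = coordinates_simps[OF c] P
  note E = coordinates_eq_iff[OF c]
  have R: "w \<star> i = f w \<cdot> i + g w \<cdot> u" for w by (subst coordinates_expand[OF c, of w]) simp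
  have L: "i \<star> w = f w \<cdot> i + g w \<cdot> v" for w by (subst coordinates_expand[OF c, of w]) simp
  have uv: "u \<star> v = 0" using right_alternative_lin[of u i v] by (simp add: R E)
  have uu: "f (u \<star> u) = 0" "g (u \<star> u) = 0" using right_alternative_lin[of u i u] uv by (simp_all add: R E)
  have vu: "v \<star> u = 0" using right_alternative[of i u] uu by (simp add: L)
  have vv: "v \<star> v = 0" using right_alternative_lin[of v i u] vu by simp
  define l where "l = h (u \<star> u)"
  have uu: "u \<star> u = l \<cdot> v" using uu by (simp add: E l_def)
  show classified
  proof (cases "l = 0")
    case True
    \<comment> \<open>The entry \<open>u + v - v\<close> is \<open>u\<close>, kept in the shape
      \<open>y - z\<close> that \<open>R13I\<close> demands.\<close>
    have "table3 i (u + v) v i v 0 (u + v - v) 0 0 0 0 0"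
      using True by (simp add: table3_def E basis3I[OF c] uu vu uv vv)
    then show ?thesis by (rule R13I)
  next
    case False
    \<comment> \<open>The first vector is again idempotent, and it annihilates \<open>u - v\<close>
      from the left because \<open>u \<star> u = l \<cdot> v\<close> cancels
      \<open>i \<star> u = v\<close>.\<close>
    have "table3 (i - (1 / l) \<cdot> u) (u - v) (l \<cdot> v) (i - (1 / l) \<cdot> u) 0 0 (u - v) (l \<cdot> v) 0 0 0 0"
      using False by (simp add: table3_def E basis3I[OF c] uu vu uv vv field_simps)
    then show ?thesis by (rule R09I)
  qed
qed

text \<open>Polarisation would make \<open>v \<star> u\<close> an eigenvector of right
  multiplication by \<open>i\<close> for the eigenvalue 2, so it vanishes. The other products of
  \<open>u\<close> and \<open>v\<close> follow in turn, and only \<open>v \<star> v\<close>, a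
  multiple of \<open>u\<close>, can survive.\<close>

lemma classified_rank2_left_jordan:
  assumes b: "basis3 i u v" and P: "i \<star> i = i" "i \<star> u = u" "u \<star> i = u" "i \<star> v = v + u" "v \<star> i = 0"
  shows classified
proof -
  obtain f g h where c: "coordinates i u v f g h" using b by (rule exists_coordinates)
  note [simp] = coordinates_simps[OF c] P
  note E = coordinates_eq_iff[OF c]
  have R: "w \<star> i = f w \<cdot> i + g w \<cdot> u" for w by (subst coordinates_expand[OF c, of w]) simp
  have L: "i \<star> w = f w \<cdot> i + g w \<cdot> u + h w \<cdot> (v + u)" for w
    by (subst coordinates_expand[OF c, of w]) simp
  have vu: "v \<star> u = 0" using right_alternative_lin[of v i u] by (simp add: R E)
  have vv: "h (v \<star> v) = 0" using right_alternative_lin[of v i v] vu by (simp add: R E)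
  have uv: "u \<star> v = 0" using right_alternative[of i v] vv by (simp add: L E)
  have uu: "u \<star> u = 0" using right_alternative_lin[of i u v] vu uv by simp
  define l m where "l = f (v \<star> v)" and "m = g (v \<star> v)"
  have vv: "v \<star> v = l \<cdot> i + m \<cdot> u" using vv by (simp add: E l_def m_def)
  have l: "l = 0" using right_alternative[of v v] by (simp add: vv vu uv E)
  show classified
  proof (cases "m = 0")
    case True
    have "table3 i (v - u) u i (v - u + u) u (- u) 0 0 u 0 0"
      using True l by (simp add: table3_def E basis3I[OF c] uu vu uv vv)
    then show ?thesis by (rule R04I)
  next
    case False
    \<comment> \<open>The corrected idempotent is a left unit: the extra \<open>u\<close> in
      \<open>i \<star> v\<close> is cancelled by \<open>v \<star> v = m \<cdot> u\<close>.\<close>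
    have "table3 (i - (1 / m) \<cdot> v) (v + u) (m \<cdot> u) (i - (1 / m) \<cdot> v) (v + u) (m \<cdot> u) 0 (m \<cdot> u) 0 (m \<cdot> u) 0 0"
      using False l by (simp add: table3_def E basis3I[OF c] uu vu uv vv field_simps)
    then show ?thesis by (rule R10I)
  qed
qed

text \<open>The digits are the eigenvalues of left multiplication by \<open>i\<close> on \<open>u\<close> and \<open>v\<close>.\<close>

lemma classified_rank2_00:
  assumes b: "basis3 i u v" and P: "i \<star> i = i" "i \<star> u = 0" "u \<star> i = u" "i \<star> v = 0" "v \<star> i = 0"
  shows classified
proof -
  obtain f g h where c: "coordinates i u v f g h" using b by (rule exists_coordinates)
  note [simp] = coordinates_simps[OF c] P
  note E = coordinates_eq_iff[OF c]
  have R: "w \<star> i = f w \<cdot> i + g w \<cdot> u" for w by (subst coordinates_expand[OF c, of w]) simp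
  have L: "i \<star> w = f w \<cdot> i" for w by (subst coordinates_expand[OF c, of w]) simp
  define l m n where "l = h (u \<star> u)" and "m = g (v \<star> u)" and "n = h (v \<star> v)"
  have uu: "u \<star> u = l \<cdot> v" using right_alternative_lin[of u i u] by (simp add: R E l_def)
  have uv: "u \<star> v = 0" using right_alternative_lin[of u i v] by (simp add: R E)
  have vv: "v \<star> v = n \<cdot> v" using right_alternative_lin[of v i v] by (simp add: R E n_def)
  have vu: "v \<star> u = m \<cdot> u" using right_alternative_lin[of v i u] right_alternative_lin[of i u v] uv by (simp add: R L E m_def)
  have lm: "l * m = 0" using right_alternative[of u u] by (simp add: uu uv vu E)
  have "l * m = l * n" using right_alternative[of v u] by (simp add: uu vv vu E)
  with lm have ln: "l * n = 0" by simp
  have mn: "m * (n - m) = 0" using right_alternative_lin[of v u v] by (simp add: uu uv vv vu E algebra_simps)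
  consider "l \<noteq> 0" "m = 0" "n = 0" | "l = 0" "m = 0" "n = 0" | "l = 0" "n \<noteq> 0" "m = 0"
    | "l = 0" "n \<noteq> 0" "m = n" using lm ln mn by auto
  then show classified
  proof cases
    case 1
    then have "table3 i u (l \<cdot> v) i 0 0 u (l \<cdot> v) 0 0 0 0"
      by (simp add: table3_def E basis3I[OF c] uu vu uv vv)
    then show ?thesis by (rule R09I)
  next
    case 2
    then have "table3 i u v i 0 0 u 0 0 0 0 0"
      by (simp add: table3_def E basis3I[OF c] uu vu uv vv)
    then show ?thesis by (rule R12I)
  next
    case 3
    then have "table3 i ((1 / n) \<cdot> v) u i 0 0 0 ((1 / n) \<cdot> v) 0 u 0 0"
      by (simp add: table3_def E basis3I[OF c] uu vu uv vv)
    then show ?thesis by (rule R16I)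
  next
    case 4
    then have "table3 ((1 / n) \<cdot> v) i u ((1 / n) \<cdot> v) 0 u 0 i 0 0 u 0"
      by (simp add: table3_def E basis3I[OF c] uu vu uv vv)
    then show ?thesis by (rule R11I)
  qed
qed

lemma classified_rank2_01:
  assumes b: "basis3 i u v" and P: "i \<star> i = i" "i \<star> u = 0" "u \<star> i = u" "i \<star> v = v" "v \<star> i = 0"
  shows classified
proof -
  obtain f g h where c: "coordinates i u v f g h" using b by (rule exists_coordinates)
  note [simp] = coordinates_simps[OF c] P
  note E = coordinates_eq_iff[OF c]
  have R: "w \<star> i = f w \<cdot> i + g w \<cdot> u" for w by (subst coordinates_expand[OF c, of w]) simp
  have L: "i \<star> w = f w \<cdot> i + h w \<cdot> v" for w by (subst coordinates_expand[OF c, of w]) simp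
  define k l where "k = f (v \<star> u)" and "l = f (v \<star> v)"
  have uu: "u \<star> u = 0" using right_alternative_lin[of u i u] right_alternative[of i u] by (simp add: R L E)
  have "h (v \<star> u) = 0" "f (u \<star> v) = 0" "g (u \<star> v) = 0"
    using right_alternative_lin[of v i u] right_alternative_lin[of u i v] by (simp_all add: R E)
  with right_alternative_lin[of i u v] have uv: "u \<star> v = 0" and vu: "v \<star> u = k \<cdot> i" by (simp_all add: L E k_def)
  have vv: "v \<star> v = l \<cdot> i"
    using right_alternative_lin[of v i v] right_alternative[of i v] by (simp add: R L E l_def)
  have l: "l = 0" using right_alternative[of u v] by (simp add: uv vv E)
  have k: "k = 0" using right_alternative_lin[of v u v] l by (simp add: uv vv vu E)
  have "table3 i u v i 0 v u 0 0 0 0 0"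
    using k l by (simp add: table3_def E basis3I[OF c] uu vu uv vv)
  then show ?thesis by (rule R08I)
qed

text \<open>The algebra is the direct sum of the unital plane of \<open>i\<close> and
  \<open>u\<close> and the line of \<open>v\<close>. The plane is the dual numbers or a sum of two
  copies of the field, and the line has zero product or is spanned by an idempotent, whence four
  cases.\<close>

lemma classified_rank2_10:
  assumes b: "basis3 i u v" and P: "i \<star> i = i" "i \<star> u = u" "u \<star> i = u" "i \<star> v = 0" "v \<star> i = 0"
    and uu: "u \<star> u = 0 \<or> u \<star> u = u"
  shows classified
proof -
  obtain f g h where c: "coordinates i u v f g h" using b by (rule exists_coordinates)
  note [simp] = coordinates_simps[OF c] P
  note E = coordinates_eq_iff[OF c]
  have R: "w \<star> i = f w \<cdot> i + g w \<cdot> u" for w by (subst coordinates_expand[OF c, of w]) simp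
  define n where "n = h (v \<star> v)"
  have vu: "v \<star> u = 0" using right_alternative_lin[of v i u] by (simp add: R E)
  have uv: "u \<star> v = 0" using right_alternative_lin[of u i v] by (simp add: R E)
  have vv: "v \<star> v = n \<cdot> v" using right_alternative_lin[of v i v] by (simp add: R E n_def)
  consider "u \<star> u = 0" "n = 0" | "u \<star> u = 0" "n \<noteq> 0" | "u \<star> u = u" "n = 0" | "u \<star> u = u" "n \<noteq> 0"
    using uu by auto
  then show classified
  proof cases
    case 1
    then have "table3 i u v i u 0 u 0 0 0 0 0"
      by (simp add: table3_def E basis3I[OF c] vu uv vv)
    then show ?thesis by (rule A02I)
  next
    case 2
    then have "table3 ((1 / n) \<cdot> v) i u ((1 / n) \<cdot> v) 0 0 0 i u 0 u 0"
      by (simp add: table3_def E basis3I[OF c] vu uv vv)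
    then show ?thesis by (rule A08I)
  next
    case 3
    then have "table3 (i - u) u v (i - u) 0 0 0 u 0 0 0 0"
      by (simp add: table3_def E basis3I[OF c] vu uv vv)
    then show ?thesis by (rule A01I)
  next
    case 4
    then have "table3 (i - u) u ((1 / n) \<cdot> v) (i - u) 0 0 0 u 0 0 0 ((1 / n) \<cdot> v)"
      by (simp add: table3_def E basis3I[OF c] vu uv vv)
    then show ?thesis by (rule A07I)
  qed
qed

text \<open>Here \<open>i\<close> is a left unit and \<open>u\<close> acts on \<open>v\<close> from
  the left by the scalar \<open>k\<close>, which is 0 or 1 when \<open>u\<close> is idempotent.
  Exchanging \<open>u\<close> and \<open>i - u\<close> interchanges these two values, so both lead
  to \<open>R15\<close>.\<close>

lemma classified_rank2_11:
  assumes b: "basis3 i u v" and P: "i \<star> i = i" "i \<star> u = u" "u \<star> i = u" "i \<star> v = v" "v \<star> i = 0"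
    and uu: "u \<star> u = 0 \<or> u \<star> u = u"
  shows classified
proof -
  obtain f g h where c: "coordinates i u v f g h" using b by (rule exists_coordinates)
  note [simp] = coordinates_simps[OF c] P
  note E = coordinates_eq_iff[OF c]
  have R: "w \<star> i = f w \<cdot> i + g w \<cdot> u" for w by (subst coordinates_expand[OF c, of w]) simp
  define k l m where "k = h (u \<star> v)" and "l = f (v \<star> v)" and "m = g (v \<star> v)"
  have vu: "v \<star> u = 0" using right_alternative_lin[of v i u] by (simp add: R E)
  have uv: "u \<star> v = k \<cdot> v" using right_alternative_lin[of u i v] by (simp add: R E k_def)
  have vv: "v \<star> v = l \<cdot> i + m \<cdot> u" using right_alternative_lin[of v i v] by (simp add: R E l_def m_def)
  have lmk: "l + m * k = 0" using right_alternative[of v v] by (simp add: uv vv vu E)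
  from uu show classified
  proof
    assume uu: "u \<star> u = 0"
    have k: "k = 0" using right_alternative_lin[of u u v] by (simp add: uv vu uu E)
    with lmk have l: "l = 0" by simp
    show ?thesis
    proof (cases "m = 0")
      case True
      then have "table3 i v u i v u 0 0 0 u 0 0"
        using k l by (simp add: table3_def E basis3I[OF c] uu vu uv vv)
      then show ?thesis by (rule R03I)
    next
      case False
      then have "table3 i v (m \<cdot> u) i v (m \<cdot> u) 0 (m \<cdot> u) 0 (m \<cdot> u) 0 0"
        using k l by (simp add: table3_def E basis3I[OF c] uu vu uv vv)
      then show ?thesis by (rule R10I)
    qed
  next
    assume uu: "u \<star> u = u"
    have "k = k * k" using right_alternative_lin[of u u v] by (simp add: uv vu uu E)
    then have "k = 0 \<or> k = 1" by auto
    then show ?thesis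
    proof
      assume k: "k = 0"
      have "l = 0" "m = 0" using lmk right_alternative[of u v] k by (simp_all add: uv vv uu E)
      then have "table3 (i - u) u v (i - u) 0 v 0 u 0 0 0 0"
        using k by (simp add: table3_def E basis3I[OF c] uu vu uv vv)
      then show ?thesis by (rule R15I)
    next
      assume k: "k = 1"
      have "l = 0" "m = 0" using lmk right_alternative[of u v] k by (simp_all add: uv vv uu E)
      then have "table3 u (i - u) v u 0 v 0 (i - u) 0 0 0 0"
        using k by (simp add: table3_def E basis3I[OF c] uu vu uv vv)
      then show ?thesis by (rule R15I)
    qed
  qed
qed

text \<open>Completing the square: \<open>w = u - (b / 2) \<cdot> i\<close> has square
  \<open>(a + b^2 / 4) \<cdot> i\<close>. If this scalar is zero, \<open>w\<close> has square zero;
  otherwise, with \<open>s\<close> a square root of it, half of \<open>i + (1 / s) \<cdot> w\<close>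
  is idempotent. A nonzero \<open>c\<close> keeps the new element independent of \<open>i\<close>
  whenever \<open>u\<close> is.\<close>

lemma nilpotent_or_idempotent_in_unital_plane:
  assumes P: "i \<star> i = i" "i \<star> u = u" "u \<star> i = u" and uu: "u \<star> u = a \<cdot> i + b \<cdot> u"
  obtains c d where "c \<noteq> 0"
    "(c \<cdot> u + d \<cdot> i) \<star> (c \<cdot> u + d \<cdot> i) = 0 \<or>
     (c \<cdot> u + d \<cdot> i) \<star> (c \<cdot> u + d \<cdot> i) = c \<cdot> u + d \<cdot> i"
proof -
  have sq: "(c \<cdot> u + d \<cdot> i) \<star> (c \<cdot> u + d \<cdot> i) =
    (c * c * b + c * d + c * d) \<cdot> u + (c * c * a + d * d) \<cdot> i" for c d
    unfolding scale_left_distrib by (simp add: P uu algebra_simps)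
  show thesis
  proof (cases "a + b * b / 4 = 0")
    case True
    have "(1 \<cdot> u + (- b / 2) \<cdot> i) \<star> (1 \<cdot> u + (- b / 2) \<cdot> i) = 0"
      using True unfolding sq by (simp add: algebra_simps)
    then show thesis using that[of 1 "- b / 2"] by simp
  next
    case False
    define s where "s = csqrt (a + b * b / 4)"
    have s: "s * s = a + b * b / 4" "s \<noteq> 0"
      using False power2_csqrt[of "a + b * b / 4"] by (auto simp: s_def power2_eq_square)
    have a: "a = s * s - b * b / 4" using s by simp
    let ?c = "1 / (2 * s)" and ?d = "1 / 2 - b / (4 * s)"
    have "?c * ?c * b + ?c * ?d + ?c * ?d = ?c" "?c * ?c * a + ?d * ?d = ?d"
      using s(2) unfolding a by (simp_all add: field_simps)
    then have "(?c \<cdot> u + ?d \<cdot> i) \<star> (?c \<cdot> u + ?d \<cdot> i) = ?c \<cdot> u + ?d \<cdot> i"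
      unfolding sq by simp
    then show thesis using that[of ?c ?d] s by simp
  qed
qed

text \<open>Write L and R for left and right multiplication by \<open>i\<close>. Polarisation at
  \<open>i, i, x\<close> reads L + RL = LL + LR, and the two systems of equations are this on
  \<open>u\<close> and \<open>v\<close>. The solutions are a nilpotent block, or a triangular L with
  entries 0 and 1 on the diagonal.\<close>

lemma classified_rank2:
  assumes b: "basis3 i u v" and P: "i \<star> i = i" "u \<star> i = u" "v \<star> i = 0"
  shows classified
proof -
  obtain f g h where c: "coordinates i u v f g h" using b by (rule exists_coordinates)
  note [simp] = coordinates_simps[OF c] P
  note E = coordinates_eq_iff[OF c]
  define p q r s t d where "p = f (i \<star> u)" and "q = g (i \<star> u)" and "r = h (i \<star> u)"
    and "s = f (i \<star> v)" and "t = g (i \<star> v)" and "d = h (i \<star> v)"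
  have iu: "i \<star> u = p \<cdot> i + q \<cdot> u + r \<cdot> v" and iv: "i \<star> v = s \<cdot> i + t \<cdot> u + d \<cdot> v"
    by (simp_all add: E p_def q_def r_def s_def t_def d_def)
  have 1: "q * p + r * s = 0" "q * q + r * t = q" "r * (q + d) = 0"
    using right_alternative_lin[of i i u] by (simp_all add: iu iv E algebra_simps)
  have 2: "s = t * p + d * s" "t * (q + d) = 2 * t" "d = t * r + d * d"
    using right_alternative_lin[of i i v] by (simp_all add: iu iv E algebra_simps)
  show classified
  proof (cases "r = 0")
    case False
    then have "d = - q" using 1(3) by (simp add: eq_neg_iff_add_eq_0 add.commute)
    then have "2 * q = 0" using 1(2) 2(3) by algebra
    then have z: "q = 0" "d = 0" "t = 0" "s = 0" using 1 False \<open>d = - q\<close> by auto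
    show ?thesis
      by (rule classified_rank2_left_nilpotent[of i "u - p \<cdot> i" "r \<cdot> v"])
        (simp_all add: z False E basis3I[OF c] iu iv)
  next
    case True
    note r = this
    have q: "q = 0 \<or> q = 1" and d: "d = 0 \<or> d = 1" using 1(2) 2(3) r by auto
    define u' where "u' = u - p \<cdot> i"
    have u': "u' \<star> i = u'" "i \<star> u' = q \<cdot> u'" using 1(1) r q by (auto simp: u'_def iu E)
    have iv': "i \<star> v = s \<cdot> i + t \<cdot> u' + d \<cdot> v" 
      using 1(1) 2 r q d by (auto simp: u'_def E iv)
    have b': "basis3 i u' v" by (simp add: basis3I[OF c] u'_def)
    obtain f' g' h' where c': "coordinates i u' v f' g' h'" using b' by (rule exists_coordinates)
    note cs' = coordinates_simps[OF c']
    note E' = coordinates_eq_iff[OF c']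
    have R: "w \<star> i = f' w \<cdot> i + g' w \<cdot> u'" for w
      by (subst coordinates_expand[OF c', of w]) (simp add: u')
    \<comment> \<open>Since \<open>v \<star> v\<close> has no component along \<open>v\<close>,
      comparing that component in the law for \<open>i, v, v\<close> leaves only
      \<open>s\<close>.\<close>
    have s0: "s = 0" if dt: "d = 1" "t = 0"
    proof -
      have "h' (v \<star> v) = 0"
        using right_alternative_lin[of v i v] by (simp add: iv' dt R E' cs')
      moreover have "i \<star> w = f' w \<cdot> i + (q * g' w) \<cdot> u' + h' w \<cdot> (s \<cdot> i + v)" for w
        by (subst coordinates_expand[OF c', of w]) (simp add: u' iv' dt mult.commute)
      ultimately show ?thesis
        using right_alternative[of i v] by (simp add: iv' dt E' cs')
    qed
    \<comment> \<open>For \<open>q = 1\<close> the plane of \<open>i\<close> and \<open>u'\<close>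
      is closed with unit \<open>i\<close>, so \<open>u'\<close> may be replaced by an element that
      is idempotent or has square zero.\<close>
    have reduce: classified if sub: "\<And>w. basis3 i w v \<Longrightarrow> i \<star> w = w \<Longrightarrow> w \<star> i = w \<Longrightarrow>
        w \<star> w = 0 \<or> w \<star> w = w \<Longrightarrow> classified" and q: "q = 1"
    proof -
      have "h' (u' \<star> u') = 0" using right_alternative_lin[of u' i u'] u' q by (simp add: R E' cs')
      then have sq: "u' \<star> u' = f' (u' \<star> u') \<cdot> i + g' (u' \<star> u') \<cdot> u'" by (simp add: E' cs')
      have "i \<star> u' = u'" using u' q by simp
      then obtain k l where k: "k \<noteq> 0"
        "(k \<cdot> u' + l \<cdot> i) \<star> (k \<cdot> u' + l \<cdot> i) = 0 \<or>
         (k \<cdot> u' + l \<cdot> i) \<star> (k \<cdot> u' + l \<cdot> i) = k \<cdot> u' + l \<cdot> i"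
        using u'(1) sq by (rule nilpotent_or_idempotent_in_unital_plane[OF P(1)])
      show classified
        by (rule sub[of "k \<cdot> u' + l \<cdot> i"]) (use k u' q in \<open>simp_all add: cs' basis3I[OF c']\<close>)
    qed
    consider "d = 0" "q = 0" | "d = 0" "q = 1" | "d = 1" "q = 0" | "d = 1" "q = 1" "t = 0"
      | "d = 1" "q = 1" "t \<noteq> 0" using q d by auto
    then show ?thesis
    proof cases
      case 1
      with 2 have "t = 0" "s = 0" by auto
      with 1 show ?thesis by (intro classified_rank2_00[of i u' v]) (use b' u' iv' in simp_all)
    next
      case 2
      with \<open>t * (q + d) = 2 * t\<close> \<open>s = t * p + d * s\<close> have "t = 0" "s = 0" by auto
      with 2 have "i \<star> v = 0" by (simp add: iv')
      with 2(2) show ?thesis by (intro reduce[OF classified_rank2_10[OF _ P(1) _ _ _ P(3)]]) (simp_all add: P)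
    next
      case 3
      with 2 have "t = 0" by auto
      with 3 s0 have "i \<star> v = v" by (simp add: iv')
      with 3 show ?thesis by (intro classified_rank2_01[of i u' v]) (use b' u' in simp_all)
    next
      case 4
      with s0 have "i \<star> v = v" by (simp add: iv')
      with 4(2) show ?thesis by (intro reduce[OF classified_rank2_11[OF _ P(1) _ _ _ P(3)]]) (simp_all add: P)
    next
      case 5
      \<comment> \<open>Taking the whole difference \<open>i \<star> v - v\<close> as the second
        basis vector puts L in Jordan form.\<close>
      show ?thesis
        by (rule classified_rank2_left_jordan[of i "s \<cdot> i + t \<cdot> u'" v])
          (use 5 u' iv' in \<open>simp_all add: E' cs' basis3I[OF c']\<close>)
    qed
  qed
qed

section \<open>Idempotents of rank one\<close>

text \<open>Right multiplication by \<open>i\<close> is a projection, because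
  \<open>(x \<star> i) \<star> i = x \<star> (i \<star> i)\<close>, and
  \<open>x - x \<star> i\<close> lies in its kernel. The coefficient \<open>m\<close> of a third
  basis vector decides whether the kernel is a plane or a line, and a line means rank two.\<close>

lemma rank_one_or_classified:
  assumes idem: "i \<star> i = i" and nz: "i \<noteq> 0" and rank: "\<exists>x. x \<star> i \<noteq> x"
  shows "(\<exists>u v. basis3 i u v \<and> u \<star> i = 0 \<and> v \<star> i = 0) \<or> classified"
proof -
  obtain x where x: "x \<star> i \<noteq> x" using rank by blast
  define v where "v = x - x \<star> i"
  have v: "v \<star> i = 0" "v \<noteq> 0" using x right_alternative[of x i] by (auto simp: v_def idem)
  have "a = 0 \<and> b = 0" if "a \<cdot> i + b \<cdot> v = 0" for a b
  proof -
    have "(a \<cdot> i + b \<cdot> v) \<star> i = 0" using that by simp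
    then have "a = 0" using v nz by (simp add: idem)
    with that v show ?thesis by simp
  qed
  then obtain w where b: "basis3 i v w" by (rule exists_basis3_2)
  obtain f g h where c: "coordinates i v w f g h" using b by (rule exists_coordinates)
  note [simp] = coordinates_simps[OF c] idem v(1)
  note E = coordinates_eq_iff[OF c]
  define k l m where "k = f (w \<star> i)" and "l = g (w \<star> i)" and "m = h (w \<star> i)"
  have wi: "w \<star> i = k \<cdot> i + l \<cdot> v + m \<cdot> w" by (simp add: E k_def l_def m_def)
  have *: "m * k = 0" "m * l = l" "m * m = m"
    using right_alternative[of w i] by (simp_all add: wi E)
  then have "m = 0 \<or> m = 1" by auto
  then show ?thesis
  proof
    assume "m = 0"
    with * have "basis3 i v (w - k \<cdot> i)" "(w - k \<cdot> i) \<star> i = 0" by (simp_all add: wi E basis3I[OF c])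
    then show ?thesis using v by blast
  next
    assume "m = 1"
    with * have "basis3 i (w + l \<cdot> v) v" "(w + l \<cdot> v) \<star> i = w + l \<cdot> v"
      by (simp_all add: wi E basis3I[OF c])
    then show ?thesis using v classified_rank2 by simp
  qed
qed

text \<open>Of the products of \<open>u\<close> and \<open>v\<close> only
  \<open>u \<star> u = s \<cdot> u\<close> and \<open>v \<star> u = r \<cdot> v\<close> can survive,
  and the law for \<open>v, u, u\<close> forces \<open>r\<close> to be 0 or
  \<open>s\<close>.\<close>

lemma classified_rank1_01:
  assumes b: "basis3 i u v" and P: "i \<star> i = i" "u \<star> i = 0" "v \<star> i = 0" "i \<star> u = 0" "i \<star> v = v"
  shows classified
proof -
  obtain f g h where c: "coordinates i u v f g h" using b by (rule exists_coordinates)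
  note [simp] = coordinates_simps[OF c] P
  note E = coordinates_eq_iff[OF c]
  have R: "w \<star> i = f w \<cdot> i" for w by (subst coordinates_expand[OF c, of w]) simp
  have L: "i \<star> w = f w \<cdot> i + h w \<cdot> v" for w by (subst coordinates_expand[OF c, of w]) simp
  define l r s where "l = f (v \<star> v)" and "r = h (v \<star> u)" and "s = g (u \<star> u)"
  have uu: "u \<star> u = s \<cdot> u" 
    using right_alternative_lin[of u i u] right_alternative[of i u] by (simp add: R L E s_def)
  have vv: "v \<star> v = l \<cdot> i" using right_alternative_lin[of v i v] by (simp add: R L E l_def)
  have l: "l = 0" using right_alternative[of v v] by (simp add: vv E)
  have "f (v \<star> u) = 0" "g (u \<star> v) = 0" "h (u \<star> v) = 0"
    using right_alternative_lin[of v i u] right_alternative_lin[of u i v] by (simp_all add: R E)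
  with right_alternative_lin[of i u v] have uv: "u \<star> v = 0" and vu: "v \<star> u = r \<cdot> v" by (simp_all add: L E r_def)
  have "r * r = r * s" using right_alternative[of v u] by (simp add: uu vu E)
  then consider "s = 0" "r = 0" | "s \<noteq> 0" "r = 0" | "s \<noteq> 0" "r = s" by auto
  then show classified
  proof cases
    case 1
    then have "table3 i v u i v 0 0 0 0 0 0 0"
      using l by (simp add: table3_def E basis3I[OF c] uu vu uv vv)
    then show ?thesis by (rule R14I)
  next
    case 2
    then have "table3 i ((1 / s) \<cdot> u) v i 0 v 0 ((1 / s) \<cdot> u) 0 0 0 0"
      using l by (simp add: table3_def E basis3I[OF c] uu vu uv vv)
    then show ?thesis by (rule R15I)
  next
    case 3
    then have "table3 i ((1 / s) \<cdot> u) v i 0 v 0 ((1 / s) \<cdot> u) 0 0 v 0"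
      using l by (simp add: table3_def E basis3I[OF c] uu vu uv vv)
    then show ?thesis by (rule R11I)
  qed
qed

text \<open>Formally \<open>x\<close> is a root of \<open>t^3 - c t^2 - b t\<close>. If
  \<open>b\<close> is nonzero, \<open>(1 / b) \<cdot> (y - c \<cdot> x)\<close> acts as a unit on
  the span of \<open>x\<close> and \<open>y\<close>; otherwise
  \<open>y \<star> y = (c^2) \<cdot> y\<close> and \<open>y\<close> is rescaled. A nonzero
  \<open>q\<close> guarantees a nonzero idempotent when \<open>x\<close> and \<open>y\<close> are
  independent.\<close>

lemma idempotent_of_cubic:
  assumes xx: "x \<star> x = y" and yx: "y \<star> x = b \<cdot> x + c \<cdot> y" and nz: "b \<noteq> 0 \<or> c \<noteq> 0"
  obtains p q where "(p \<cdot> x + q \<cdot> y) \<star> (p \<cdot> x + q \<cdot> y) = p \<cdot> x + q \<cdot> y" "q \<noteq> 0"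
proof -
  have xy: "x \<star> y = b \<cdot> x + c \<cdot> y" using right_alternative[of x x] xx yx by simp
  have yy: "y \<star> y = b \<cdot> y + c \<cdot> (b \<cdot> x + c \<cdot> y)" using right_alternative[of y x] xx yx by simp
  have sq: "(p \<cdot> x + q \<cdot> y) \<star> (p \<cdot> x + q \<cdot> y) =
    (p * q * b + p * q * b + q * q * c * b) \<cdot> x +
    (p * p + p * q * c + p * q * c + q * q * (b + c * c)) \<cdot> y" for p q
    unfolding scale_left_distrib by (simp add: xx xy yx yy algebra_simps)
  show thesis
  proof (cases "b = 0")
    case True
    then show thesis using that[of 0 "1 / (c * c)"] nz sq[of 0 "1 / (c * c)"] by simp
  next
    case False
    let ?p = "- c / b" and ?q = "1 / b"
    have "?p * ?q * b + ?p * ?q * b + ?q * ?q * c * b = ?p"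
      "?p * ?p + ?p * ?q * c + ?p * ?q * c + ?q * ?q * (b + c * c) = ?q"
      using False by (simp_all add: field_simps)
    then show thesis using that[of ?p ?q] False sq[of ?p ?q] by simp
  qed
qed

text \<open>Products of \<open>u\<close> and \<open>v\<close> are multiples of \<open>i\<close>,
  which acts on \<open>u\<close> and \<open>v\<close> as the identity from the left and as zero from
  the right; the right alternative law therefore kills them.\<close>

lemma classified_rank1_11:
  assumes b: "basis3 i u v" and P: "i \<star> i = i" "u \<star> i = 0" "v \<star> i = 0" "i \<star> u = u" "i \<star> v = v"
  shows classified
proof -
  obtain f g h where c: "coordinates i u v f g h" using b by (rule exists_coordinates)
  note [simp] = coordinates_simps[OF c] P
  note E = coordinates_eq_iff[OF c]
  have R: "w \<star> i = f w \<cdot> i" for w by (subst coordinates_expand[OF c, of w]) simp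
  define k l m n where "k = f (u \<star> u)" and "l = f (u \<star> v)" and "m = f (v \<star> u)" and "n = f (v \<star> v)"
  have uu: "u \<star> u = k \<cdot> i" using right_alternative_lin[of u i u] by (simp add: R E k_def)
  have uv: "u \<star> v = l \<cdot> i" using right_alternative_lin[of u i v] by (simp add: R E l_def)
  have vu: "v \<star> u = m \<cdot> i" using right_alternative_lin[of v i u] by (simp add: R E m_def)
  have vv: "v \<star> v = n \<cdot> i" using right_alternative_lin[of v i v] by (simp add: R E n_def)
  have "k = 0" "l = 0" "m = 0" "n = 0"
    using right_alternative[of u u] right_alternative[of u v] right_alternative[of v u]
      right_alternative[of v v] by (simp_all add: uu uv vu vv E)
  then have "table3 i u v i u v 0 0 0 0 0 0" by (simp add: table3_def basis3I[OF c] uu uv vu vv)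
  then show ?thesis by (rule R06I)
qed

text \<open>The zero set of \<open>f\<close> is a plane closed under multiplication and annihilated
  by \<open>i\<close> on both sides, so the problem drops to dimension two. An idempotent in this
  plane leads back to rank two; without one, either the plane has zero product or it is spanned by
  some \<open>x\<close> and \<open>x \<star> x\<close> with vanishing cube.\<close>

lemma classified_rank1_00:
  assumes b: "basis3 i u v" and P: "i \<star> i = i" "u \<star> i = 0" "v \<star> i = 0" "i \<star> u = 0" "i \<star> v = 0"
  shows classified
proof -
  obtain f g h where c: "coordinates i u v f g h" using b by (rule exists_coordinates)
  note [simp] = coordinates_simps[OF c] P
  note E = coordinates_eq_iff[OF c]
  have R: "w \<star> i = f w \<cdot> i" for w by (subst coordinates_expand[OF c, of w]) simp
  have L: "i \<star> w = f w \<cdot> i" for w by (subst coordinates_expand[OF c, of w]) simp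
  have closed: "f (x \<star> y) = 0" if "f x = 0" "f y = 0" for x y
    using right_alternative_lin[of x i y] that by (simp add: R L E)
  show classified
  proof (cases "\<exists>x. f x = 0 \<and> x \<noteq> 0 \<and> x \<star> x = x")
    case True
    then obtain x where x: "f x = 0" "x \<noteq> 0" "x \<star> x = x" by blast
    have "\<exists>w. f w = 0 \<and> basis3 i x w"
    proof (cases "g x = 0")
      case True
      with x have "basis3 i x u" by (intro basis3I[OF c]) (auto simp: E)
      then show ?thesis using x by (intro exI[of _ u]) simp
    next
      case False
      with x have "basis3 i x v" by (intro basis3I[OF c]) (auto simp: E)
      then show ?thesis using x by (intro exI[of _ v]) simp
    qed
    then obtain w where w: "f w = 0" "basis3 i x w" by blast
    from w(2) obtain f' g' h' where c': "coordinates i x w f' g' h'" by (rule exists_coordinates)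
    note cs' = coordinates_simps[OF c']
    note E' = coordinates_eq_iff[OF c']
    define k m where "k = g' (w \<star> x)" and "m = h' (w \<star> x)"
    have wx: "w \<star> x = f' (w \<star> x) \<cdot> i + k \<cdot> x + m \<cdot> w" by (simp add: E' cs' k_def m_def)
    have "f' (w \<star> x) = 0" using arg_cong[OF wx, of f] x w closed[of w x] by simp
    with wx have wx: "w \<star> x = k \<cdot> x + m \<cdot> w" by simp
    have ix: "i \<star> x = 0" "x \<star> i = 0" "w \<star> i = 0" using x w by (simp_all add: L R)
    have "m * k = 0" "m * m = m"
      using right_alternative[of w x] by (simp_all add: wx x E' cs')
    then consider "m = 1" "k = 0" | "m = 0" by auto
    then show ?thesis
    proof cases
      case 1
      then show ?thesis
        by (intro classified_rank2[of x w i]) (simp_all add: wx x ix cs' basis3I[OF c'])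
    next
      case 2
      \<comment> \<open>Here \<open>x\<close> annihilates \<open>w - k \<cdot> x\<close> by right
        multiplication, so the sum of the orthogonal idempotents \<open>i\<close> and
        \<open>x\<close> has rank two.\<close>
      then show ?thesis
        by (intro classified_rank2[of "i + x" x "w - k \<cdot> x"]) (simp_all add: wx x ix cs' basis3I[OF c'])
    qed
  next
    case False
    then have no: "x = 0" if "f x = 0" "x \<star> x = x" for x using that by blast
    show ?thesis
    proof (cases "\<forall>x. f x = 0 \<longrightarrow> (\<exists>c. x \<star> x = c \<cdot> x)")
      case True
      have sq: "x \<star> x = 0" if x: "f x = 0" for x
      proof -
        obtain c where c: "x \<star> x = c \<cdot> x" using True x by blast
        then have "c = 0 \<or> (1 / c) \<cdot> x = 0" using no[of "(1 / c) \<cdot> x"] x by simp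
        with c show ?thesis by auto
      qed
      have uu: "u \<star> u = 0" and vv: "v \<star> v = 0" using sq by simp_all
      have vu: "v \<star> u = - (u \<star> v)"
        using sq[of "u + v"] uu vv by (simp add: eq_neg_iff_add_eq_0 add.commute)
      define k l where "k = g (u \<star> v)" and "l = h (u \<star> v)"
      have uv: "u \<star> v = k \<cdot> u + l \<cdot> v" using closed[of u v] by (simp add: E k_def l_def)
      have "k = 0" "l = 0"
        using right_alternative[of u v] right_alternative[of v u]
        by (simp_all add: uu vv vu uv E)
      then have "table3 i u v i 0 0 0 0 0 0 0 0"
        by (simp add: table3_def basis3I[OF c] uu uv vu vv)
      then show ?thesis by (rule A03I)
    next
      case False
      then obtain x where x: "f x = 0" and x': "\<And>c. x \<star> x \<noteq> c \<cdot> x" by blast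
      define y where "y = x \<star> x"
      have x0: "x \<noteq> 0" using x'[of 0] by auto
      have y: "f y = 0" using closed x by (simp add: y_def)
      have b: "basis3 i x y"
        unfolding basis3_def
      proof (intro allI impI)
        fix k l m assume s: "k \<cdot> i + l \<cdot> x + m \<cdot> y = 0"
        have "k = 0" using arg_cong[OF s, of f] x y by simp
        with s independent2I[of y x l m] x' x0 show "k = 0 \<and> l = 0 \<and> m = 0" by (simp add: y_def)
      qed
      then obtain f' g' h' where c': "coordinates i x y f' g' h'" by (rule exists_coordinates)
      note cs' = coordinates_simps[OF c']
      note E' = coordinates_eq_iff[OF c']
      define k m where "k = g' (y \<star> x)" and "m = h' (y \<star> x)"
      have yx: "y \<star> x = f' (y \<star> x) \<cdot> i + k \<cdot> x + m \<cdot> y" by (simp add: E' cs' k_def m_def)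
      have "f' (y \<star> x) = 0" using arg_cong[OF yx, of f] x y closed[of y x] by simp
      with yx have yx: "y \<star> x = k \<cdot> x + m \<cdot> y" by simp
      have km: "\<not> (k \<noteq> 0 \<or> m \<noteq> 0)"
      proof
        assume "k \<noteq> 0 \<or> m \<noteq> 0"
        then obtain p q where pq: "(p \<cdot> x + q \<cdot> y) \<star> (p \<cdot> x + q \<cdot> y) = p \<cdot> x + q \<cdot> y" "q \<noteq> 0"
          using idempotent_of_cubic[OF y_def[symmetric] yx] by blast
        then have "p \<cdot> x + q \<cdot> y = 0" using no x y by simp
        with pq(2) show False by (simp add: E' cs')
      qed
      with yx have yx: "y \<star> x = 0" by simp
      moreover have "x \<star> y = 0" using right_alternative[of x x] yx by (simp add: y_def)
      moreover have "y \<star> y = 0" using right_alternative[of y x] yx by (simp add: y_def)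
      ultimately have "table3 i x y i 0 0 0 y 0 0 0 0"
        using x y b by (simp add: table3_def L R y_def)
      then show ?thesis by (rule A11I)
    qed
  qed
qed

lemma classified_rank1:
  assumes b: "basis3 i u v" and P: "i \<star> i = i" "u \<star> i = 0" "v \<star> i = 0"
  shows classified
proof -
  obtain f g h where c: "coordinates i u v f g h" using b by (rule exists_coordinates)
  note [simp] = coordinates_simps[OF c] P
  note E = coordinates_eq_iff[OF c]
  have R: "w \<star> i = f w \<cdot> i" for w by (subst coordinates_expand[OF c, of w]) simp
  have i0: "i \<noteq> 0" by (simp add: E)
  \<comment> \<open>Left multiplication by \<open>i\<close> restricts to a projection of the kernel
    of right multiplication. A component \<open>k\<close> of \<open>i \<star> x\<close> along
    \<open>i\<close> is excluded through \<open>y\<close>: its square is a multiple of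
    \<open>i\<close>, and the law for \<open>i, y, y\<close> leaves
    \<open>k \<cdot> (y + k \<cdot> i) = 0\<close>.\<close>
  have left: "f (i \<star> x) = 0 \<and> i \<star> (i \<star> x) = i \<star> x" if x: "f x = 0" for x
  proof -
    define k where "k = f (i \<star> x)"
    define y where "y = i \<star> x - k \<cdot> i"
    have ii: "i \<star> (i \<star> x) = i \<star> x + k \<cdot> i"
      using right_alternative_lin[of i i x] x by (simp add: R k_def)
    then have iy: "i \<star> y = y + k \<cdot> i" by (simp add: y_def)
    have yi: "y \<star> i = 0" by (simp add: y_def R k_def)
    have "y \<star> y = f (y \<star> y) \<cdot> i"
      using right_alternative_lin[of y i y] R[of "y \<star> y"] by (simp add: iy yi)
    then obtain l where yy: "y \<star> y = l \<cdot> i" by blast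
    have "k = 0 \<or> y + k \<cdot> i = 0"
      using right_alternative[of i y] by (simp add: iy yy)
    then have "k = 0"
    proof
      assume "y + k \<cdot> i = 0"
      from arg_cong[OF this, of f] show "k = 0" by (simp add: y_def flip: k_def)
    qed
    with ii show ?thesis by (simp add: k_def)
  qed
  \<comment> \<open>A projection of a plane is the identity, zero, or has nonzero vectors in both
    kernel and image, supplied below by \<open>U\<close> and \<open>V\<close>. The numbered facts
    are \<open>f u = 0\<close> and \<open>f v = 0\<close>.\<close>
  consider "i \<star> u = u" "i \<star> v = v" | "i \<star> u = 0" "i \<star> v = 0"
    | x y where "f x = 0" "i \<star> x \<noteq> x" "f y = 0" "i \<star> y \<noteq> 0"
    by (metis coordinates_simps(19,22)[OF c])
  then show classified
  proof cases
    case 1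
    with b P show ?thesis by (rule classified_rank1_11)
  next
    case 2
    with b P show ?thesis by (rule classified_rank1_00)
  next
    case 3
    define U V where "U = x - i \<star> x" and "V = i \<star> y"
    have UV: "U \<star> i = 0" "V \<star> i = 0" "i \<star> U = 0" "i \<star> V = V" "U \<noteq> 0" "V \<noteq> 0"
      using 3 left by (auto simp: U_def V_def R)
    have "basis3 i U V"
      unfolding basis3_def
    proof (intro allI impI)
      fix k l m assume s: "k \<cdot> i + l \<cdot> U + m \<cdot> V = 0"
      have k: "k = 0" using arg_cong[OF s, of "\<lambda>w. w \<star> i"] UV i0 by simp
      have "m = 0" using arg_cong[OF s, of "\<lambda>w. i \<star> w"] UV k by simp
      with k s UV show "k = 0 \<and> l = 0 \<and> m = 0" by simp
    qed
    with UV P show ?thesis by (intro classified_rank1_01[of i U V])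
  qed
qed

section \<open>Idempotent right units\<close>

text \<open>By \<open>ii\<close> left multiplication by \<open>i\<close> is a projection, and by
  \<open>il\<close> every element annihilates its kernel from the left. Rank one of this projection
  gives \<open>R07\<close>, rank two gives \<open>R05\<close>, and rank three is the unital case
  with \<open>A09\<close> and \<open>A10\<close>.\<close>

lemma classified_right_unit:
  assumes idem: "i \<star> i = i" and nz: "i \<noteq> 0"
    and all: "\<And>w x. w \<noteq> 0 \<Longrightarrow> w \<star> w = w \<Longrightarrow> x \<star> w = x"
  shows classified
proof -
  have ri [simp]: "x \<star> i = x" for x using all nz idem by blast
  have ii: "i \<star> (i \<star> x) = i \<star> x" for x using right_alternative_lin[of i i x] by simp
  have il: "x \<star> (i \<star> y) = x \<star> y" for x y using right_alternative_lin[of x i y] by simp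
  have idem_unique: "i \<star> w = i" if "w \<star> w = w" "w \<noteq> 0" for w using all that by blast
  show ?thesis
  proof (cases "\<forall>x. i \<star> x = x")
    case False
    then obtain x where "i \<star> x \<noteq> x" by blast
    define v where "v = x - i \<star> x"
    have v: "w \<star> v = 0" for w using ii il by (simp add: v_def)
    have v0: "v \<noteq> 0" using \<open>i \<star> x \<noteq> x\<close> by (simp add: v_def)
    have "a = 0 \<and> b = 0" if "a \<cdot> i + b \<cdot> v = 0" for a b
    proof -
      have "i \<star> (a \<cdot> i + b \<cdot> v) = 0" using that by simp
      then have "a = 0" using v nz by simp
      with that v0 show ?thesis by simp
    qed
    then obtain w where b: "basis3 i v w" by (rule exists_basis3_2)
    obtain f g h where c: "coordinates i v w f g h" using b by (rule exists_coordinates)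
    note cs = coordinates_simps[OF c]
    note E = coordinates_eq_iff[OF c]
    define k l m where "k = f (i \<star> w)" and "l = g (i \<star> w)" and "m = h (i \<star> w)"
    have iw: "i \<star> w = k \<cdot> i + l \<cdot> v + m \<cdot> w" by (simp add: E cs k_def l_def m_def)
    have *: "m * k = 0" "m * l = l" "m * m = m"
      using ii[of w] by (simp_all add: iw E cs v)
    then have "m = 0 \<or> m = 1" by auto
    then show ?thesis
    proof
      assume m: "m = 0"
      have u: "z \<star> (w - k \<cdot> i) = 0" for z
        using il[of z w] * m by (simp add: iw)
      have "table3 i v (w - k \<cdot> i) i 0 0 v 0 0 (w - k \<cdot> i) 0 0"
        using u v by (simp add: table3_def basis3I[OF c] cs)
      then show ?thesis by (rule R07I)
    next
      assume m: "m = 1"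
      define u where "u = w + l \<cdot> v"
      have b': "basis3 i u v" by (simp add: basis3I[OF c] cs u_def)
      have iu: "i \<star> u = u" using m * by (simp add: u_def iw v)
      obtain f' g' h' where c': "coordinates i u v f' g' h'" using b' by (rule exists_coordinates)
      note cs' = coordinates_simps[OF c']
      note E' = coordinates_eq_iff[OF c']
      have L: "i \<star> w = f' w \<cdot> i + g' w \<cdot> u" for w
        by (subst coordinates_expand[OF c', of w]) (simp add: iu v)
      have "h' (u \<star> u) = 0" using right_alternative[of i u] iu by (simp add: L E' cs')
      then have "u \<star> u = f' (u \<star> u) \<cdot> i + g' (u \<star> u) \<cdot> u" by (simp add: E' cs')
      then obtain k l where k: "k \<noteq> 0"
        "(k \<cdot> u + l \<cdot> i) \<star> (k \<cdot> u + l \<cdot> i) = 0 \<or>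
         (k \<cdot> u + l \<cdot> i) \<star> (k \<cdot> u + l \<cdot> i) = k \<cdot> u + l \<cdot> i"
        by (rule nilpotent_or_idempotent_in_unital_plane[OF idem iu ri])
      define u' where "u' = k \<cdot> u + l \<cdot> i"
      have iu': "i \<star> u' = u'" by (simp add: u'_def iu)
      \<comment> \<open>A nonzero idempotent \<open>u'\<close> would be a right unit, so
        \<open>i \<star> u'\<close> would be \<open>i\<close> as well as \<open>u'\<close>.\<close>
      have "u' \<star> u' \<noteq> u'"
      proof
        assume "u' \<star> u' = u'"
        moreover have "u' \<noteq> 0" "u' \<noteq> i" using k(1) by (simp_all add: u'_def E' cs')
        ultimately show False using idem_unique[of u'] iu' by simp
      qed
      with k(2) have uu: "u' \<star> u' = 0" by (simp add: u'_def)
      have b'': "basis3 i v u'" using k(1) by (simp add: basis3I[OF c'] cs' u'_def)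
      obtain f'' g'' h'' where c'': "coordinates i v u' f'' g'' h''" 
        using b'' by (rule exists_coordinates)
      note cs'' = coordinates_simps[OF c'']
      note E'' = coordinates_eq_iff[OF c'']
      have L: "i \<star> w = f'' w \<cdot> i + h'' w \<cdot> u'" for w
        by (subst coordinates_expand[OF c'', of w]) (simp add: iu' v)
      define r where "r = g'' (v \<star> u')"
      have vu: "v \<star> u' = r \<cdot> v"
        using right_alternative_lin[of i u' v] by (simp add: v L E'' cs'' r_def)
      have "r = 0" using right_alternative[of v u'] by (simp add: uu vu E'' cs'')
      then have "table3 i v u' i 0 u' v 0 0 u' 0 0"
        using b'' by (simp add: table3_def v vu uu iu')
      then show ?thesis by (rule R05I)
    qed
  next
    case True
    then have li [simp]: "i \<star> x = x" for x by simp
    have only: "w = i" if "w \<star> w = w" "w \<noteq> 0" for w using idem_unique[OF that] by simp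
    show ?thesis
    \<comment> \<open>Either every element satisfies a quadratic equation, and two elements of
      square zero complement \<open>i\<close>, or the unit, some \<open>x\<close> and its square
      form a basis.\<close>
    proof (cases "\<forall>x. \<exists>a b. x \<star> x = a \<cdot> i + b \<cdot> x")
      case True
      obtain u0 v0 where b0: "basis3 i u0 v0" using nz by (rule exists_basis3_1)
      obtain f g h where c0: "coordinates i u0 v0 f g h" using b0 by (rule exists_coordinates)
      note cs0 = coordinates_simps[OF c0]
      note E0 = coordinates_eq_iff[OF c0]
      have nil: "\<exists>k l. k \<noteq> 0 \<and> (k \<cdot> x + l \<cdot> i) \<star> (k \<cdot> x + l \<cdot> i) = 0"
        if x: "g x \<noteq> 0 \<or> h x \<noteq> 0" for x
      proof -
        obtain a b where "x \<star> x = a \<cdot> i + b \<cdot> x" using True by blast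
        then obtain k l where k: "k \<noteq> 0"
          "(k \<cdot> x + l \<cdot> i) \<star> (k \<cdot> x + l \<cdot> i) = 0 \<or>
           (k \<cdot> x + l \<cdot> i) \<star> (k \<cdot> x + l \<cdot> i) = k \<cdot> x + l \<cdot> i"
          by (rule nilpotent_or_idempotent_in_unital_plane[OF idem li ri])
        moreover have "k \<cdot> x + l \<cdot> i \<noteq> 0" "k \<cdot> x + l \<cdot> i \<noteq> i"
          using k(1) x by (auto simp: E0 cs0)
        ultimately show ?thesis using only by blast
      qed
      obtain k l where k: "k \<noteq> 0" "(k \<cdot> u0 + l \<cdot> i) \<star> (k \<cdot> u0 + l \<cdot> i) = 0"
        using nil[of u0] by (auto simp: cs0)
      obtain m n where m: "m \<noteq> 0" "(m \<cdot> v0 + n \<cdot> i) \<star> (m \<cdot> v0 + n \<cdot> i) = 0"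
        using nil[of v0] by (auto simp: cs0)
      define u v where "u = k \<cdot> u0 + l \<cdot> i" and "v = m \<cdot> v0 + n \<cdot> i"
      have uu: "u \<star> u = 0" and vv: "v \<star> v = 0" using k m by (simp_all add: u_def v_def)
      have b: "basis3 i u v" using k(1) m(1) by (simp add: basis3I[OF c0] cs0 u_def v_def)
      obtain f g h where c: "coordinates i u v f g h" using b by (rule exists_coordinates)
      note cs = coordinates_simps[OF c]
      note E = coordinates_eq_iff[OF c]
      define p q r p' q' r' where "p = f (u \<star> v)" and "q = g (u \<star> v)" and "r = h (u \<star> v)"
        and "p' = f (v \<star> u)" and "q' = g (v \<star> u)" and "r' = h (v \<star> u)"
      have uv: "u \<star> v = p \<cdot> i + q \<cdot> u + r \<cdot> v" and vu: "v \<star> u = p' \<cdot> i + q' \<cdot> u + r' \<cdot> v"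
        by (simp_all add: E cs p_def q_def r_def p'_def q'_def r'_def)
      have q: "q = 0" using right_alternative[of u v] by (simp add: uv vv E cs)
      have p: "p = 0" using right_alternative[of u v] q by (simp add: uv vv E cs)
      have r': "r' = 0" using right_alternative[of v u] by (simp add: vu uu E cs)
      have p': "p' = 0" using right_alternative[of v u] r' by (simp add: vu uu E cs)
      have "r = 0" using right_alternative_lin[of u u v] by (simp add: uu uv vu p q p' r' E cs)
      moreover have "q' = 0" using right_alternative_lin[of v v u] by (simp add: vv uv vu p q p' r' E cs)
      ultimately have "table3 i u v i u v u 0 0 v 0 0"
        using b by (simp add: table3_def uu vv uv vu p q p' r')
      then show ?thesis by (rule A09I)
    next
      case False
      then obtain x where x: "\<And>a b. x \<star> x \<noteq> a \<cdot> i + b \<cdot> x" by blast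
      have "x \<noteq> c \<cdot> i" for c using x[of 0 c] by auto
      then have b: "basis3 i x (x \<star> x)" using nz x by (rule basis3I_extend)
      define y where "y = x \<star> x"
      obtain f g h where c: "coordinates i x y f g h"
        using b unfolding y_def by (rule exists_coordinates)
      note cs = coordinates_simps[OF c]
      note E = coordinates_eq_iff[OF c]
      define p q r where "p = f (y \<star> x)" and "q = g (y \<star> x)" and "r = h (y \<star> x)"
      have yx: "y \<star> x = p \<cdot> i + q \<cdot> x + r \<cdot> y" by (simp add: E cs p_def q_def r_def)
      \<comment> \<open>Shifting \<open>x\<close> by a root of its cubic removes the constant term,
        so that \<open>idempotent_of_cubic\<close> applies to \<open>x'\<close>; \<open>q'\<close>
        and \<open>r'\<close> are the coefficients of the shifted cubic.\<close>
      obtain s where "poly [:- p, - q, - r, 1:] s = 0"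
        using fundamental_theorem_of_algebra_alt[of "[:- p, - q, - r, 1:]"] by auto
      then have s: "s * s * s = p + q * s + r * s * s" by (simp add: algebra_simps)
      define x' where "x' = x - s \<cdot> i"
      define y' where "y' = x' \<star> x'"
      have xx: "x \<star> x = y" by (simp add: y_def)
      have y': "y' = y - (2 * s) \<cdot> x + (s * s) \<cdot> i" by (simp add: y'_def x'_def E cs xx)
      define q' r' where "q' = q + 2 * s * r - 3 * s * s" and "r' = r - 3 * s"
      have yx': "y' \<star> x' = q' \<cdot> x' + r' \<cdot> y'"
        using s by (simp add: y' x'_def E cs xx yx q'_def r'_def algebra_simps)
      have b': "basis3 i x' y'" by (simp add: basis3I[OF c] y' x'_def cs)
      obtain f' g' h' where c': "coordinates i x' y' f' g' h'"
        using b' by (rule exists_coordinates)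
      note cs' = coordinates_simps[OF c']
      note E' = coordinates_eq_iff[OF c']
      have "\<not> (q' \<noteq> 0 \<or> r' \<noteq> 0)"
      proof
        assume "q' \<noteq> 0 \<or> r' \<noteq> 0"
        then obtain k l where kl: "(k \<cdot> x' + l \<cdot> y') \<star> (k \<cdot> x' + l \<cdot> y') = k \<cdot> x' + l \<cdot> y'" "l \<noteq> 0"
          using idempotent_of_cubic[OF y'_def[symmetric] yx'] by blast
        moreover have "k \<cdot> x' + l \<cdot> y' \<noteq> 0" "k \<cdot> x' + l \<cdot> y' \<noteq> i"
          using kl(2) by (simp_all add: E' cs')
        ultimately show False using only by blast
      qed
      with yx' have yx': "y' \<star> x' = 0" by simp
      moreover have "x' \<star> y' = 0" using right_alternative[of x' x'] yx' by (simp add: y'_def)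
      moreover have "y' \<star> y' = 0" using right_alternative[of y' x'] yx' by (simp add: y'_def)
      ultimately have "table3 i x' y' i x' y' x' y' 0 y' 0 0"
        using b' by (simp add: table3_def y'_def)
      then show ?thesis by (rule A10I)
    qed
  qed
qed

lemma classified_of_idempotent:
  assumes "i \<star> i = i" "i \<noteq> 0"
  shows classified
proof (cases "\<exists>w x. w \<noteq> 0 \<and> w \<star> w = w \<and> x \<star> w \<noteq> x")
  case True
  then obtain w where "w \<noteq> 0" "w \<star> w = w" "\<exists>x. x \<star> w \<noteq> x" by blast
  then show ?thesis using rank_one_or_classified[of w] classified_rank1[of w] by blast
next
  case False
  with assms show ?thesis by (intro classified_right_unit[of i]) blast+
qed

section \<open>Algebras without idempotents\<close>

lemma double_eq_0:
  fixes v :: 'a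
  assumes "v + v = 0"
  shows "v = 0"
proof -
  from assms have "2 \<cdot> v = 0" using scale_left_distrib[of 1 1 v] by simp
  then show ?thesis by simp
qed

text \<open>Read \<open>x\<close>, \<open>y\<close>, \<open>z\<close> as powers of \<open>t\<close>
  with \<open>t^4 = a t + b t^2 + c t^3\<close>, and split the relation into a power of
  \<open>t\<close> and a cofactor with nonzero constant term. The element that is rescaled
  (\<open>k\<close>, or \<open>z\<close> in the last case) is divisible by that power and a nonzero
  constant modulo the cofactor, hence a multiple of an idempotent.\<close>

lemma idempotent_of_quartic:
  assumes yx: "y \<star> x = z" and xx: "x \<star> x = y" and zx: "z \<star> x = a \<cdot> x + b \<cdot> y + c \<cdot> z"
    and nz: "a \<noteq> 0 \<or> b \<noteq> 0 \<or> c \<noteq> 0" and b3: "basis3 x y z"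
  obtains w where "w \<star> w = w" "w \<noteq> 0"
proof -
  obtain f g h where co: "coordinates x y z f g h" using b3 by (rule exists_coordinates)
  note cs = coordinates_simps[OF co] and E = coordinates_eq_iff[OF co]
  note scaled_idem = that
  have xy: "x \<star> y = z" using right_alternative[of x x] xx yx by simp
  have yy: "y \<star> y = z \<star> x" using right_alternative[of y x] xx yx by simp
  \<comment> \<open>Right multiplications by \<open>y\<close> and \<open>z\<close> are the square
    and cube of that by \<open>x\<close>, which stands in for associativity of powers.\<close>
  have wy: "w \<star> y = (w \<star> x) \<star> x" for w using right_alternative[of w x] xx by simp
  have wz: "(w \<star> x) \<star> y + (w \<star> y) \<star> x = w \<star> z + w \<star> z" for w
    using right_alternative_lin[of w x y] xy yx by simp
  have scaled: thesis if "k \<star> k = d \<cdot> k" "d \<noteq> 0" "k \<noteq> 0" for k d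
    using scaled_idem[of "(1 / d) \<cdot> k"] that by simp
  consider "a \<noteq> 0" | "a = 0" "b \<noteq> 0" | "a = 0" "b = 0" "c \<noteq> 0" using nz by blast
  then show thesis
  proof cases
    case 1
    define k where "k = z - c \<cdot> y - b \<cdot> x"
    have kx: "k \<star> x = a \<cdot> x" by (simp add: k_def zx yx xx)
    have ky: "k \<star> y = a \<cdot> y" using wy[of k] by (simp add: kx xx)
    have kz: "k \<star> z = a \<cdot> z" using wz[of k] by (simp add: kx ky xy yx E cs)
    have "k \<star> k = k \<star> (z - c \<cdot> y - b \<cdot> x)" by (simp only: k_def)
    also have "\<dots> = a \<cdot> (z - c \<cdot> y - b \<cdot> x)"
      by (simp add: kx ky kz E cs)
    finally have "k \<star> k = a \<cdot> k" by (simp only: k_def)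
    then show ?thesis by (rule scaled) (use 1 in \<open>simp_all add: k_def E cs\<close>)
  next
    case 2
    define k where "k = (b + c * c) \<cdot> y - c \<cdot> z"
    have kx: "k \<star> x = b \<cdot> z - (b * c) \<cdot> y"
      using 2 by (simp add: k_def zx yx E cs algebra_simps)
    have ky: "k \<star> y = (b * b) \<cdot> y"
      using wy[of k] 2 by (simp add: kx zx yx E cs algebra_simps)
    have zy: "z \<star> y = b \<cdot> z + c \<cdot> (z \<star> x)" using wy[of z] 2 by (simp add: zx yx)
    have kz: "k \<star> z = (b * b) \<cdot> z"
      using wz[of k] 2 by (simp add: kx ky zx zy yx yy E cs algebra_simps)
    have "k \<star> k = k \<star> ((b + c * c) \<cdot> y - c \<cdot> z)" by (simp only: k_def)
    also have "\<dots> = (b * b) \<cdot> ((b + c * c) \<cdot> y - c \<cdot> z)"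
      by (simp add: ky kz E cs)
    finally have "k \<star> k = (b * b) \<cdot> k" by (simp only: k_def)
    then show ?thesis
    proof (rule scaled)
      show "k \<noteq> 0" using 2 by (auto simp: k_def E cs)
    qed (use 2 in simp)
  next
    case 3
    have zy: "z \<star> y = (c * c) \<cdot> z" using wy[of z] 3 by (simp add: zx)
    have "z \<star> z = (c * (c * c)) \<cdot> z" using wz[of z] 3 by (simp add: zx zy E cs)
    then show ?thesis by (rule scaled) (use 3 in \<open>simp_all add: E cs\<close>)
  qed
qed

text \<open>Polarisation at \<open>w, x, x \<star> x\<close> equates twice the cube of right
  multiplication by \<open>x\<close> with right multiplication by
  \<open>x \<star> (x \<star> x) + (x \<star> x) \<star> x\<close>, which is zero.\<close>

lemma nil3_right:
  assumes "(x \<star> x) \<star> x = 0"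
  shows "((w \<star> x) \<star> x) \<star> x = 0"
proof -
  have "x \<star> (x \<star> x) = 0" using right_alternative[of x x] assms by simp
  then have "(w \<star> x) \<star> (x \<star> x) + (w \<star> (x \<star> x)) \<star> x = 0" using right_alternative_lin[of w x "x \<star> x"] assms by simp
  then have "((w \<star> x) \<star> x) \<star> x + ((w \<star> x) \<star> x) \<star> x = 0" by (simp flip: right_alternative)
  then show ?thesis by (rule double_eq_0)
qed

text \<open>The law with vanishing squares gives \<open>w \<star> x = w \<star> y = 0\<close> for
  \<open>w = x \<star> y\<close>; multiplying a linear relation by \<open>y\<close> and by
  \<open>x\<close> then shows independence.\<close>

lemma classified_anticommutative:
  assumes sq: "\<And>x. x \<star> x = 0" and nz: "x \<star> y \<noteq> 0"
  shows classified
proof -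
  define w where "w = x \<star> y"
  have anti: "b \<star> a = - (a \<star> b)" for a b
    using sq[of "a + b"] sq[of a] sq[of b] by (simp add: eq_neg_iff_add_eq_0 add.commute)
  have wy: "w \<star> y = 0" using right_alternative[of x y] sq by (simp add: w_def)
  have wx: "w \<star> x = 0" using right_alternative[of y x] sq by (simp add: w_def anti[of x y])
  have "basis3 x y w"
    unfolding basis3_def
  proof (intro allI impI)
    fix a b c assume s: "a \<cdot> x + b \<cdot> y + c \<cdot> w = 0"
    have "a = 0" using arg_cong[OF s, of "\<lambda>v. v \<star> y"] nz by (simp add: sq wy)
    moreover have "b = 0" using arg_cong[OF s, of "\<lambda>v. v \<star> x"] nz by (simp add: sq wx anti[of x y])
    ultimately show "a = 0 \<and> b = 0 \<and> c = 0" using s nz by (simp add: w_def)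
  qed
  then have "table3 x y w 0 w 0 (- w) 0 0 0 0 0"
    using sq anti[of w x] anti[of w y] wx wy by (simp add: table3_def anti[of x y] w_def)
  then show ?thesis by (rule R00I)
qed

text \<open>Multiplication is a bilinear form on the span of \<open>x\<close> and \<open>z\<close>
  with values in the line of \<open>y\<close>. \<open>s\<close> and \<open>t\<close> are the
  off-diagonal entries of its symmetric and skew parts, and \<open>d\<close> is the determinant of
  the symmetric part; \<open>z - s \<cdot> x\<close> is orthogonal to \<open>x\<close> for the
  symmetric part and has square \<open>d \<cdot> y\<close>.\<close>

lemma classified_bilinear_form:
  assumes b: "basis3 x y z" and P: "x \<star> x = y" "x \<star> y = 0" "y \<star> x = 0" "y \<star> y = 0"
    "y \<star> z = 0" "z \<star> y = 0" and xz: "x \<star> z = k \<cdot> y" "z \<star> x = l \<cdot> y" "z \<star> z = m \<cdot> y"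
  shows classified
proof -
  obtain f g h where c: "coordinates x y z f g h" using b by (rule exists_coordinates)
  note cs = coordinates_simps[OF c] and E = coordinates_eq_iff[OF c]
  define s t d where "s = (k + l) / 2" and "t = (k - l) / 2" and "d = m - s * s"
  have k: "k = s + t" and l: "l = s - t" and m: "m = d + s * s"
    by (simp_all add: s_def t_def d_def field_simps)
  show ?thesis
  proof (cases "d = 0")
    case d: True
    show ?thesis
    proof (cases "t = 0")
      case True
      with d have "table3 x y (z - s \<cdot> x) y 0 0 0 0 0 0 0 0"
        by (simp add: table3_def basis3I[OF c] cs P xz k l m E algebra_simps)
      then show ?thesis by (rule A04I)
    next
      case False
      with d have "table3 x y ((1 / t) \<cdot> (z - s \<cdot> x)) y 0 y 0 0 0 (- y) 0 0"
        by (simp add: table3_def basis3I[OF c] cs P xz k l m E algebra_simps)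
      then show ?thesis by (rule R01I)
    qed
  next
    case False
    define r where "r = csqrt d"
    have d: "d = r * r" and r: "r \<noteq> 0"
      using False power2_csqrt[of d] by (auto simp: r_def power2_eq_square)
    \<comment> \<open>The square of \<open>?z\<close> is \<open>- y\<close>, so
      \<open>x + ?z\<close> and \<open>x - ?z\<close> have square zero; \<open>?a\<close> is the
      parameter of \<open>R02\<close>, and its value zero corresponds to \<open>A05\<close>.\<close>
    let ?z = "(\<i> / r) \<cdot> (z - s \<cdot> x)" and ?a = "- \<i> * t / r"
    have "table3 (x + ?z) (x - ?z) (2 \<cdot> y) 0 ((1 + ?a) \<cdot> (2 \<cdot> y)) 0 ((1 - ?a) \<cdot> (2 \<cdot> y)) 0 0 0 0 0"
      using r by (simp add: table3_def basis3I[OF c] cs P xz k l m d E field_simps)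
    note tab = this
    show ?thesis
    proof (cases "t = 0")
      case True
      with tab have "table3 (x + ?z) (x - ?z) (2 \<cdot> y) 0 (2 \<cdot> y) 0 (2 \<cdot> y) 0 0 0 0 0" by simp
      then show ?thesis by (rule A05I)
    next
      case False
      from tab show ?thesis by (rule R02I) (use False r in simp)
    qed
  qed
qed

text \<open>Vanishing cubes make right multiplications nilpotent, which removes the coefficients
  \<open>m\<close> and \<open>k\<close>. The polarised cube and the right alternative law then
  confine all products to the line of \<open>y\<close>.\<close>

lemma classified_nil3:
  assumes nil: "\<And>w. (w \<star> w) \<star> w = 0" and nz: "x \<star> x \<noteq> 0"
  shows classified
proof -
  define y where "y = x \<star> x"
  have xx: "x \<star> x = y" and yx: "y \<star> x = 0" and y0: "y \<noteq> 0"
    using nil nz by (simp_all add: y_def)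
  have xy: "x \<star> y = 0" using right_alternative[of x x] xx yx by simp
  have yy: "y \<star> y = 0" using right_alternative[of y x] xx yx by simp
  have "a = 0 \<and> b = 0" if s: "a \<cdot> x + b \<cdot> y = 0" for a b
  proof -
    have "a = 0" using arg_cong[OF s, of "\<lambda>v. v \<star> x"] y0 by (simp add: xx yx)
    with s y0 show ?thesis by simp
  qed
  then obtain z where b: "basis3 x y z" by (rule exists_basis3_2)
  obtain f g h where c: "coordinates x y z f g h" using b by (rule exists_coordinates)
  note cs = coordinates_simps[OF c] and E = coordinates_eq_iff[OF c]
  note P = xx yx xy yy
  define k l m where "k = f (z \<star> x)" and "l = g (z \<star> x)" and "m = h (z \<star> x)"
  define p q r where "p = f (x \<star> z)" and "q = g (x \<star> z)" and "r = h (x \<star> z)"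
  have zx: "z \<star> x = k \<cdot> x + l \<cdot> y + m \<cdot> z" and xz: "x \<star> z = p \<cdot> x + q \<cdot> y + r \<cdot> z"
    by (simp_all add: E cs k_def l_def m_def p_def q_def r_def)
  have m: "m = 0" using nil3_right[where w = z, OF nil[of x]] by (simp add: zx P E cs)
  have zy: "z \<star> y = k \<cdot> y" using right_alternative[of z x] by (simp add: zx P m)
  \<comment> \<open>\<open>?p\<close> is the part of the cube of \<open>x + z\<close> linear in
    \<open>z\<close>; subtracting the cube of \<open>x - z\<close> isolates it up to the cube of
    \<open>z\<close>.\<close>
  let ?p = "y \<star> z + (x \<star> z) \<star> x + (z \<star> x) \<star> x"
  have "?p + ?p = ((x + z) \<star> (x + z)) \<star> (x + z) - ((x - z) \<star> (x - z)) \<star> (x - z) -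
      (z \<star> z) \<star> z - (z \<star> z) \<star> z"
    by (simp add: xx algebra_simps)
  also have "\<dots> = 0" by (simp only: nil) simp
  finally have p0: "?p = 0" by (rule double_eq_0)
  then have yz: "y \<star> z = - ((x \<star> z) \<star> x) - (z \<star> x) \<star> x"
    by (simp add: algebra_simps eq_neg_iff_add_eq_0)
  have r: "r = 0" using right_alternative_lin[of x x z] yz by (simp add: zx xz P m E cs)
  have p: "p = - (2 * k)" using right_alternative_lin[of x x z] yz r
    by (simp add: zx xz P m E cs) (simp add: eq_neg_iff_add_eq_0 algebra_simps)
  have yz: "y \<star> z = k \<cdot> y" using yz by (simp add: zx xz P m p r E cs)
  have k: "k = 0" using nil3_right[where w = y, OF nil[of z]] by (simp add: yz E cs)
  define a b' d where "a = f (z \<star> z)" and "b' = g (z \<star> z)" and "d = h (z \<star> z)"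
  have zz: "z \<star> z = a \<cdot> x + b' \<cdot> y + d \<cdot> z" by (simp add: E cs a_def b'_def d_def)
  have d: "d = 0" using nil[of z] by (simp add: zz xz yz p k r E cs)
  have a: "a = 0" using right_alternative[of x z] by (simp add: zz xz yz p k r d P E cs)
  show ?thesis
    by (rule classified_bilinear_form[where k = q and l = l and m = b', OF b P(1) P(3) P(2) P(4)])
      (use zz zx xz yz zy in \<open>simp_all add: a d k m p r\<close>)
qed

text \<open>No listed algebra has zero multiplication, whence the assumption of a nonzero
  product.\<close>

lemma classification:
  assumes nz: "x \<star> y \<noteq> 0"
  shows classified
proof (cases "\<exists>i. i \<star> i = i \<and> i \<noteq> 0")
  case True
  then show ?thesis using classified_of_idempotent by blast
next
  case False
  then have no: "w = 0" if "w \<star> w = w" for w using that by blast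
  have sq0: "w \<star> w = 0" if "w \<star> w = c \<cdot> w" for w c
    using no[of "(1 / c) \<cdot> w"] that by (cases "c = 0") auto
  show ?thesis
  proof (cases "\<exists>w. (w \<star> w) \<star> w \<noteq> 0")
    case True
    then obtain w where w: "(w \<star> w) \<star> w \<noteq> 0" by blast
    define v z where "v = w \<star> w" and "z = v \<star> w"
    have v: "v \<noteq> c \<cdot> w" for c using sq0[of w c] w by (auto simp: v_def)
    have "w \<noteq> 0" using w by auto
    \<comment> \<open>A dependence would be a nonzero cubic relation for \<open>w\<close>, and
      \<open>idempotent_of_cubic\<close> would produce a nonzero idempotent.\<close>
    have z: "z \<noteq> a \<cdot> w + b \<cdot> v" for a b
    proof
      assume zab: "z = a \<cdot> w + b \<cdot> v"
      have "a \<noteq> 0 \<or> b \<noteq> 0" using w zab by (auto simp: z_def v_def)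
      then obtain p q where pq: "(p \<cdot> w + q \<cdot> v) \<star> (p \<cdot> w + q \<cdot> v) = p \<cdot> w + q \<cdot> v" "q \<noteq> 0"
        using idempotent_of_cubic[OF v_def[symmetric] zab[unfolded z_def]] by blast
      with no independent2I[OF v \<open>w \<noteq> 0\<close>, of p q] show False by blast
    qed
    have b: "basis3 w v z" using v \<open>w \<noteq> 0\<close> z by (rule basis3I_extend)
    obtain f g h where c: "coordinates w v z f g h" using b by (rule exists_coordinates)
    have zw: "z \<star> w = f (z \<star> w) \<cdot> w + g (z \<star> w) \<cdot> v + h (z \<star> w) \<cdot> z"
      by (rule coordinates_expand[OF c])
    have "\<not> (f (z \<star> w) \<noteq> 0 \<or> g (z \<star> w) \<noteq> 0 \<or> h (z \<star> w) \<noteq> 0)"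
      using idempotent_of_quartic[OF z_def[symmetric] v_def[symmetric] zw _ b] no by metis
    with zw have zw: "z \<star> w = 0" by simp
    have wv: "w \<star> v = z" using right_alternative[of w w] by (simp add: v_def z_def)
    have vv: "v \<star> v = 0" using right_alternative[of v w] zw by (simp add: v_def z_def)
    have zv: "z \<star> v = 0" using right_alternative[of z w] zw by (simp add: v_def)
    have "w \<star> z + w \<star> z = 0" using right_alternative_lin[of w w v] zw vv wv by (simp flip: v_def z_def)
    moreover have "v \<star> z + v \<star> z = 0" using right_alternative_lin[of v v w] zw vv zv wv by (simp flip: z_def)
    moreover have "z \<star> z + z \<star> z = 0" using right_alternative_lin[of z w v] zw zv wv by (simp flip: z_def)
    ultimately have "w \<star> z = 0" "v \<star> z = 0" "z \<star> z = 0" by (auto dest: double_eq_0)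
    then have "table3 w v z v z 0 z 0 0 0 0 0"
      using b zw wv vv zv by (simp add: table3_def flip: v_def z_def)
    then show ?thesis by (rule A06I)
  next
    case False
    then show ?thesis
      using classified_nil3 classified_anticommutative[OF _ nz] by blast
  qed
qed

end

section \<open>From two-generated subalgebras to the list, and back to the cyclic identity\<close>

theorem corollary18:
  fixes scale :: "complex \<Rightarrow> 'a::ab_group_add \<Rightarrow> 'a"
    and mul :: "'a \<Rightarrow> 'a \<Rightarrow> 'a"
  assumes "complex_algebra scale mul"
    and "vector_space.dim scale UNIV = 3"
    and "complex_algebra.binary_minus_one_one scale mul"
  shows "((\<exists>x y. mul x y \<noteq> 0) \<longrightarrow>
            (\<exists>B \<in> {A01, A02, A03, A04, A05, A06, A07, A08, A09, A10, A11,
                    R00, R01, R03, R04, R05, R06, R07, R08, R09, R10, R11,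
                    R12, R13, R14, R15, R16} \<union> {R02 \<alpha> | \<alpha>. \<alpha> \<noteq> 0}.
               isomorphic_algebras scale mul (*s) B)) \<and>
         complex_algebra.minus_one_one mul"
proof -
  interpret complex_algebra scale mul by (rule assms(1))
  \<comment> \<open>Inside the subalgebra generated by \<open>x\<close> and \<open>y\<close> the
    associator of \<open>x, y, y\<close> equals its own negative, hence is zero.\<close>
  have ra: "mul (mul x y) y = mul x (mul y y)" for x y
  proof -
    have "x \<in> subalgebra hull {x, y}" "y \<in> subalgebra hull {x, y}"
      by (simp_all add: hull_inc)
    then have "associator x y y = - associator x y y"
      using assms(3)
      unfolding binary_minus_one_one_def minus_one_one_on_def right_alternative_on_def by blast
    then have "associator x y y + associator x y y = 0" by (simp add: eq_neg_iff_add_eq_0)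
    then have "scale 2 (associator x y y) = 0"
      using scale_left_distrib[of 1 1 "associator x y y"] by simp
    then show ?thesis by (simp add: associator_def)
  qed
  interpret right_alternative_3d scale mul
    by unfold_locales (rule assms(2), rule ra)
  have "associator x y z = - associator x z y" for x y z
    using right_alternative_lin[of x y z] by (simp add: associator_def algebra_simps)
  \<comment> \<open>For nonzero multiplication the identity is pulled back along the isomorphism
    with a listed algebra; otherwise all associators vanish.\<close>
  moreover have "associator x y z + associator y z x + associator z x y = 0" for x y z
  proof (cases "\<exists>x y. mul x y \<noteq> 0")
    case True
    then obtain B where B: "B \<in> listed" "isomorphic_algebras scale mul (*s) B"
      using classification unfolding classified_def by blast
    then obtain f where f: "Vector_Spaces.linear scale (*s) f" "bij f"
      and fm: "\<And>x y. f (mul x y) = B (f x) (f y)"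
      unfolding isomorphic_algebras_def by blast
    interpret f: Vector_Spaces.linear scale "(*s)" f by (rule f(1))
    have "f (associator x y z + associator y z x + associator z x y) = 0"
      unfolding associator_def f.add f.diff fm by (rule listed_cyclic[OF B(1)])
    then show ?thesis using f(2) f.zero by (metis bij_pointE)
  next
    case False
    then show ?thesis by (simp add: associator_def)
  qed
  ultimately have minus_one_one
    unfolding minus_one_one_def minus_one_one_on_def right_alternative_on_def by blast
  then show ?thesis
    using classification unfolding classified_def listed_def by blast
qed

end
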